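(* Let $c>0$, let $X=(X_n)_{n\ge 0}$ be the once-reinforced random walk on $\mathbb Z$ with parameter $c$, and let $R_n=\max_{k\le n}X_k-\min_{k\le n}X_k$ be its range by time $n$. Then for every $\ell=1,2,\dots$, as $n\to\infty$, $$\mathbb E\Big[\Big(\frac{R_n}{\sqrt n}\Big)^{\ell}\Big]\sim \frac{1}{2^{(\ell-2)/2}\,\Gamma(\ell/2)}\cdot J_\ell(c),\qquad\text{where}\qquad J_\ell(c):=2^{2c}\int_0^\infty x^{\ell-1}\Big(\frac{e^{x}}{(e^x+1)^{2}}\Big)^c\,dx .$$ In particular, $$\mathbb E\Big[\frac{R_n}{\sqrt n}\Big]\sim\sqrt{\frac{2}{\pi}}\cdot J_1(c)\qquad\text{and}\qquad \mathbb E\Big[\frac{R_n^2}{n}\Big]\sim J_2(c).$$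
   Context: Notation: $a_n\sim b_n$ means $a_n/b_n\to 1$ as $n\to\infty$; $\Gamma$ is the Gamma function. Once-reinforced random walk (ORRW) with parameter $c>0$: the $\mathbb Z$-valued process $X=(X_n)_{n=0,1,2,\dots}$ with $X_0=0$ such that, writing $M_n:=\max_{k\le n}X_k$ and $m_n:=\min_{k\le n}X_k$, conditionally on $X_0,\dots,X_n$ one has $X_{n+1}=X_n+1$ with probability - $\frac{1}{1+c}$ if $X_n=M_n$ and $M_n\ne m_n$, - $\frac12$ if $X_n\ne m_n,M_n$, - $\frac{c}{1+c}$ if $X_n=m_n$ and $M_n\neq m_n$, - $\frac12$ if $n=0$ (the only time at which $M_n=m_n$), and $X_{n+1}=X_n-1$ with the complementary conditional probability. In other words, $X_{n+1}=X_n\pm1$ with probability proportional to $c$ or $1$ according to whether $X$ has or has not visited $X_n\pm1$ before time $n$. The case $0<c<1$ is included. The range is $R_n:=M_n-m_n$. *)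

theory Defs
  imports "HOL-Probability.Probability" "HOL-Library.Landau_Symbols"
begin

definition path_max :: "(nat \<Rightarrow> int) \<Rightarrow> nat \<Rightarrow> int" where
  "path_max x n = Max (x ` {..n})"

definition path_min :: "(nat \<Rightarrow> int) \<Rightarrow> nat \<Rightarrow> int" where
  "path_min x n = Min (x ` {..n})"

definition path_range :: "(nat \<Rightarrow> int) \<Rightarrow> nat \<Rightarrow> int" where
  "path_range x n = path_max x n - path_min x n"

text \<open>
  Probability of an up-step after the history \<open>x 0, \<dots>, x n\<close>. Already visited neighbours have
  weight \<open>c\<close>, new ones weight \<open>1\<close>. For a nearest-neighbour path the first case is just \<open>n = 0\<close>.
\<close>

definition orrw_up_prob :: "real \<Rightarrow> (nat \<Rightarrow> int) \<Rightarrow> nat \<Rightarrow> real" where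
  "orrw_up_prob c x n =
     (if path_max x n = path_min x n then 1 / 2
      else if x n = path_max x n then 1 / (1 + c)
      else if x n = path_min x n then c / (1 + c)
      else 1 / 2)"

text \<open>
  The walk may live on any probability space. Its conditional law given the past is
  specified through elementary conditional probabilities on histories of positive probability;
  of the path \<open>x\<close> only \<open>x 0, \<dots>, x n\<close> matter.
\<close>

locale once_reinforced_random_walk = prob_space M
  for M :: "'a measure" and X :: "nat \<Rightarrow> 'a \<Rightarrow> int" and c :: real +
  assumes measurable_walk: "\<And>n. X n \<in> measurable M (count_space UNIV)"
    and start: "AE \<omega> in M. X 0 \<omega> = 0"
    and step_up:
      "\<And>n x. \<P>(\<omega> in M. \<forall>k\<le>n. X k \<omega> = x k) > 0 \<Longrightarrow>
         \<P>(\<omega> in M. X (Suc n) \<omega> = X n \<omega> + 1 \<bar> \<forall>k\<le>n. X k \<omega> = x k) = orrw_up_prob c x n"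
    and step_down:
      "\<And>n x. \<P>(\<omega> in M. \<forall>k\<le>n. X k \<omega> = x k) > 0 \<Longrightarrow>
         \<P>(\<omega> in M. X (Suc n) \<omega> = X n \<omega> - 1 \<bar> \<forall>k\<le>n. X k \<omega> = x k) = 1 - orrw_up_prob c x n"

definition walk_range :: "(nat \<Rightarrow> 'a \<Rightarrow> int) \<Rightarrow> nat \<Rightarrow> 'a \<Rightarrow> real" where
  "walk_range X n \<omega> = real_of_int (path_range (\<lambda>k. X k \<omega>) n)"

definition J :: "nat \<Rightarrow> real \<Rightarrow> real" where
  "J l c = 2 powr (2 * c) *
     (LBINT x:{0<..}. x ^ (l - 1) * (exp x / (exp x + 1)\<^sup>2) powr c)"

end

theory Submission
  imports Defs "HOL-Real_Asymp.Real_Asymp"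
begin

text \<open>
  The range grows in successive crossings. When the range has just become \<open>j\<close>, the walk sits at one
  end of an interval of length \<open>j\<close>; the time until the range becomes \<open>j + 1\<close> is independent of the
  past, and its generating function at \<open>s = 1 / cosh \<theta>\<close> is
  \<open>1 / (cosh \<theta> + c * sinh \<theta> * tanh (\<theta> * j / 2))\<close>. The product over \<open>j < N\<close> is the generating
  function of the time at which the range reaches \<open>N\<close> (\<open>hitting_time_generating_function\<close>). If
  \<open>\<theta>\<close> tends to \<open>0\<close> and \<open>N\<close> is close to \<open>x / \<theta>\<close>, then minus the logarithm of the product is a
  Riemann sum of \<open>c * tanh (y / 2)\<close> over \<open>{0..x}\<close>, so the product tends to
  \<open>cosh (x / 2) powr (- 2 * c)\<close> (\<open>hitting_gf_scaling_limit\<close>). Apart from the power of \<open>x\<close>, this is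
  the integrand of \<open>J\<close> together with its prefactor \<open>2 powr (2 * c)\<close>.

  The \<open>l\<close>-th moment of the range at time \<open>n\<close> is the integral of \<open>l * x ^ (l - 1)\<close> against the
  probability that the range has reached \<open>x\<close> by time \<open>n\<close>. Summing its increments in time against
  powers of \<open>s\<close> gives the integral of \<open>l * x ^ (l - 1)\<close> against the product above
  (\<open>range_moment_generating_function\<close>). After rescaling by \<open>\<theta>\<close>, dominated convergence shows that
  it is asymptotic to \<open>l * J l c * \<theta> powr (- l)\<close> (\<open>moment_transform_asymptotics\<close>). With
  \<open>s = exp (- t)\<close> the parameter \<open>\<theta>\<close> is asymptotic to \<open>sqrt (2 * t)\<close>, and the increments are
  nonnegative, so Karamata's Tauberian theorem (\<open>karamata_partial_sums\<close>) recovers the moments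
  themselves: they are asymptotic to \<open>2 powr (- l / 2) * l * J l c / Gamma (l / 2 + 1)\<close> times
  \<open>n powr (l / 2)\<close>, which is the claim because \<open>Gamma (l / 2 + 1) = l / 2 * Gamma (l / 2)\<close>.

  Instead of the crossing times themselves, the proof follows the two distances of the walk from its
  current minimum and maximum. They form a Markov chain, and an explicit function of this chain,
  discounted by \<open>s ^ n\<close>, is a martingale up to the time at which the range reaches \<open>N\<close>
  (\<open>step_mean_discounted_weight\<close>).
\<close>

section \<open>Karamata's Tauberian theorem\<close>

definition gamma_kernel :: "real \<Rightarrow> real \<Rightarrow> real" where
  "gamma_kernel \<alpha> x = indicator {0<..} x * x powr (\<alpha> - 1) * exp (- x)"

lemma gamma_kernel_nonneg: "gamma_kernel \<alpha> x \<ge> 0"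
  by (simp add: gamma_kernel_def)

lemma gamma_kernel_measurable [measurable]: "gamma_kernel \<alpha> \<in> borel_measurable borel"
  unfolding gamma_kernel_def by measurable

lemma has_bochner_integral_gamma_kernel:
  assumes "\<alpha> > 0"
  shows "has_bochner_integral lborel (gamma_kernel \<alpha>) (Gamma \<alpha>)"
proof (rule has_bochner_integral_nn_integral)
  have "(\<integral>\<^sup>+x. ennreal (gamma_kernel \<alpha> x) \<partial>lborel)
      = (\<integral>\<^sup>+x. ennreal (indicator {0..} x * x powr (\<alpha> - 1) / exp x) \<partial>lborel)"
    by (intro nn_integral_cong arg_cong[where f = ennreal])
       (auto simp: gamma_kernel_def indicator_def exp_minus field_simps)
  then show "(\<integral>\<^sup>+x. ennreal (gamma_kernel \<alpha> x) \<partial>lborel) = ennreal (Gamma \<alpha>)"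
    using Gamma_conv_nn_integral_real[OF assms] by simp
qed (use assms in \<open>auto simp: gamma_kernel_nonneg intro: Gamma_real_nonneg\<close>)

text \<open>
  Rescaling the Gamma integral: against the kernel, the monomial \<open>exp (- x) ^ m\<close> has integral
  \<open>Gamma \<alpha> * (1 + m) powr (- \<alpha>)\<close>, which is the factor that a function of order
  \<open>t powr (- \<alpha>)\<close> picks up when \<open>t\<close> is replaced by \<open>(1 + m) * t\<close>. This match is what makes
  Karamata's argument work for polynomials. Real values of \<open>m\<close> above \<open>-1\<close> make the same
  formula cover every exponentially decaying weight.
\<close>
lemma has_bochner_integral_gamma_kernel_exp:
  assumes "\<alpha> > 0" "m > (-1::real)"
  shows "has_bochner_integral lborel (\<lambda>x. gamma_kernel \<alpha> x * exp (- m * x))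
           (Gamma \<alpha> * (1 + m) powr (- \<alpha>))"
proof -
  have "has_bochner_integral lborel (\<lambda>x. gamma_kernel \<alpha> (0 + (1 + m) * x))
          (Gamma \<alpha> /\<^sub>R \<bar>1 + m\<bar>)"
    using has_bochner_integral_gamma_kernel[OF assms(1)] assms(2)
    by (subst lborel_has_bochner_integral_real_affine_iff[symmetric]) auto
  then have "has_bochner_integral lborel
      (\<lambda>x. (1 + m) powr (1 - \<alpha>) * gamma_kernel \<alpha> (0 + (1 + m) * x))
      ((1 + m) powr (1 - \<alpha>) * (Gamma \<alpha> /\<^sub>R \<bar>1 + m\<bar>))"
    by (rule has_bochner_integral_mult_right)
  also have "(\<lambda>x. (1 + m) powr (1 - \<alpha>) * gamma_kernel \<alpha> (0 + (1 + m) * x))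
      = (\<lambda>x. gamma_kernel \<alpha> x * exp (- m * x))"
  proof
    fix x :: real
    show "(1 + m) powr (1 - \<alpha>) * gamma_kernel \<alpha> (0 + (1 + m) * x)
        = gamma_kernel \<alpha> x * exp (- m * x)"
    proof (cases "x > 0")
      case True
      have "(1 + m) powr (1 - \<alpha>) * ((1 + m) * x) powr (\<alpha> - 1)
          = ((1 + m) powr (1 - \<alpha>) * (1 + m) powr (\<alpha> - 1)) * x powr (\<alpha> - 1)"
        using True assms(2) by (simp add: powr_mult)
      also have "\<dots> = x powr (\<alpha> - 1)"
        using assms(2) by (simp flip: powr_add)
      finally have "(1 + m) powr (1 - \<alpha>) * ((1 + m) * x) powr (\<alpha> - 1) = x powr (\<alpha> - 1)" .
      moreover have "0 < x + m * x"
        using mult_pos_pos[of "1 + m" x] True assms(2) by (simp add: ring_distribs)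
      ultimately show ?thesis
        using True assms(2)
        by (simp add: gamma_kernel_def indicator_def ring_distribs exp_diff exp_minus field_simps exp_add)
    next
      case False
      then show ?thesis
        using assms(2) by (simp add: gamma_kernel_def zero_less_mult_iff)
    qed
  qed
  also have "(1 + m) powr (1 - \<alpha>) * (Gamma \<alpha> /\<^sub>R \<bar>1 + m\<bar>) = Gamma \<alpha> * (1 + m) powr (- \<alpha>)"
    using assms(2)
    by (simp add: powr_diff powr_minus divide_inverse)
  finally show ?thesis .
qed

text \<open>
  The factor \<open>exp x\<close> undoes the exponential of the kernel, so that only the integral of
  \<open>x powr (\<alpha> - 1)\<close> up to \<open>d\<close> remains. At \<open>d = 1\<close> this produces the limit of the partial sums.
\<close>
lemma has_bochner_integral_gamma_kernel_cutoff:
  assumes "\<alpha> > 0" "d > 0"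
  shows "has_bochner_integral lborel (\<lambda>x. gamma_kernel \<alpha> x * (exp x * indicator {..d} x))
           (d powr \<alpha> / \<alpha>)"
proof (rule has_bochner_integral_nn_integral)
  have "((\<lambda>x. x powr (\<alpha> - 1)) has_integral (d powr \<alpha> / \<alpha> - 0 powr \<alpha> / \<alpha>)) {0..d}"
  proof (rule fundamental_theorem_of_calculus_interior)
    show "continuous_on {0..d} (\<lambda>x. x powr \<alpha> / \<alpha>)"
      using assms by (intro continuous_intros continuous_on_powr') auto
    show "((\<lambda>x. x powr \<alpha> / \<alpha>) has_vector_derivative x powr (\<alpha> - 1)) (at x)"
      if "x \<in> {0<..<d}" for x
      using that assms unfolding has_real_derivative_iff_has_vector_derivative[symmetric]
      by (auto intro!: derivative_eq_intros)
  qed (use assms in auto)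
  then have "(\<integral>\<^sup>+x. ennreal (indicator {0..d} x * x powr (\<alpha> - 1)) \<partial>lborel) = ennreal (d powr \<alpha> / \<alpha>)"
    by (subst nn_integral_has_integral_lebesgue) (use assms in auto)
  moreover have "(\<integral>\<^sup>+x. ennreal (gamma_kernel \<alpha> x * (exp x * indicator {..d} x)) \<partial>lborel)
      = (\<integral>\<^sup>+x. ennreal (indicator {0..d} x * x powr (\<alpha> - 1)) \<partial>lborel)"
    by (intro nn_integral_cong arg_cong[where f = ennreal])
       (auto simp: gamma_kernel_def indicator_def exp_minus field_simps)
  ultimately show "(\<integral>\<^sup>+x. ennreal (gamma_kernel \<alpha> x * (exp x * indicator {..d} x)) \<partial>lborel)
      = ennreal (d powr \<alpha> / \<alpha>)" by simp
qed (use assms in \<open>auto simp: gamma_kernel_nonneg\<close>)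

lemma integrable_gamma_kernel_continuous:
  fixes f :: "real \<Rightarrow> real"
  assumes "\<alpha> > 0" "continuous_on UNIV f"
  shows "integrable lborel (\<lambda>x. gamma_kernel \<alpha> x * f (exp (- x)))"
proof -
  have "compact (f ` {0..1})"
    by (rule compact_continuous_image[OF continuous_on_subset[OF assms(2)]]) auto
  then obtain B where B: "\<And>y. y \<in> {0..1} \<Longrightarrow> norm (f y) \<le> B"
    using compact_imp_bounded bounded_iff by (metis image_eqI)
  have [measurable]: "f \<in> borel_measurable borel"
    using assms(2) by (rule borel_measurable_continuous_onI)
  show ?thesis
  proof (rule Bochner_Integration.integrable_bound)
    show "integrable lborel (\<lambda>x. B * gamma_kernel \<alpha> x)"
      using has_bochner_integral_gamma_kernel[OF assms(1)]
      by (auto simp: has_bochner_integral_iff)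
    show "AE x in lborel. norm (gamma_kernel \<alpha> x * f (exp (- x))) \<le> norm (B * gamma_kernel \<alpha> x)"
    proof (rule AE_I2)
      fix x :: real
      show "norm (gamma_kernel \<alpha> x * f (exp (- x))) \<le> norm (B * gamma_kernel \<alpha> x)"
      proof (cases "x > 0")
        case True
        then have "norm (f (exp (- x))) \<le> B" by (intro B) auto
        then show ?thesis
          using gamma_kernel_nonneg[of \<alpha> x]
          by (auto simp: abs_mult mult.commute[of B] intro!: mult_left_mono)
      qed (simp add: gamma_kernel_def)
    qed
  qed measurable
qed

text \<open>
  Partial sums test the coefficients against the indicator of \<open>{..1}\<close>, to which Weierstrass
  approximation does not apply; this is its continuous replacement.
\<close>
definition ramp :: "real \<Rightarrow> real \<Rightarrow> real" where
  "ramp \<epsilon> x = max 0 (min 1 ((1 + \<epsilon> - x) / \<epsilon>))"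

lemma ramp_bounds:
  assumes "\<epsilon> > 0"
  shows "indicator {..1} x \<le> ramp \<epsilon> x" "ramp \<epsilon> x \<le> indicator {..1 + \<epsilon>} x"
  using assms by (auto simp: ramp_def indicator_def field_simps)

text \<open>
  The test function with \<open>exp (- x) * ramp_test \<epsilon> (exp (- x)) = ramp \<epsilon> x\<close>. Capping the argument
  from below at \<open>exp (- 3)\<close> removes the singularity at \<open>0\<close> and changes nothing else: for
  \<open>\<epsilon> \<le> 1\<close> the ramp vanishes beyond \<open>x = 2\<close>.
\<close>
definition ramp_test :: "real \<Rightarrow> real \<Rightarrow> real" where
  "ramp_test \<epsilon> y = ramp \<epsilon> (- ln (max y (exp (- 3)))) / max y (exp (- 3))"

lemma continuous_on_ramp_test:
  assumes "\<epsilon> > 0"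
  shows "continuous_on UNIV (ramp_test \<epsilon>)"
proof -
  have "max y (exp (- 3)) \<noteq> 0" for y :: real
    using exp_gt_zero[of "-3 :: real"] by linarith
  then show ?thesis
    unfolding ramp_test_def ramp_def
    by (intro continuous_intros ballI) (use assms in auto)
qed

lemma ramp_test_exp:
  assumes "0 < \<epsilon>" "\<epsilon> \<le> 1"
  shows "ramp_test \<epsilon> (exp (- x)) = exp x * ramp \<epsilon> x"
proof (cases "x \<le> 3")
  case True
  then have "max (exp (- x)) (exp (- 3)) = exp (- x)" by (subst max_absorb1) auto
  then show ?thesis
    unfolding ramp_test_def by (simp only: ln_exp minus_minus) (simp add: field_simps flip: exp_add)
next
  case False
  then have "ramp \<epsilon> x = 0" "ramp \<epsilon> 3 = 0"
    using assms by (auto simp: ramp_def field_simps)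
  moreover have "max (exp (- x)) (exp (- 3)) = exp (- 3)"
    using False by (subst max_absorb2) auto
  ultimately show ?thesis unfolding ramp_test_def by (simp only: ln_exp) simp
qed

lemma exp_times_ramp_test:
  assumes "0 < \<epsilon>" "\<epsilon> \<le> 1"
  shows "z * exp (- x) * ramp_test \<epsilon> (exp (- x)) = z * ramp \<epsilon> x"
proof -
  have "z * exp (- x) * (exp x * ramp \<epsilon> x) = z * (exp (- x) * exp x) * ramp \<epsilon> x"
    by (simp only: mult.assoc)
  then show ?thesis by (simp add: ramp_test_exp[OF assms] flip: exp_add)
qed

text \<open>
  The hypothesis of Karamata's theorem in the variable \<open>s = exp (- t)\<close>: the generating function
  of \<open>b\<close> is asymptotic to \<open>C * t powr (- \<alpha>)\<close> as \<open>t\<close> tends to \<open>0\<close> from the right.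
\<close>
locale laplace_asymptotics =
  fixes b :: "nat \<Rightarrow> real" and \<alpha> C :: real
  assumes exponent_pos: "\<alpha> > 0"
    and coeff_nonneg: "\<And>k. b k \<ge> 0"
    and summable_laplace: "\<And>t. t > 0 \<Longrightarrow> summable (\<lambda>k. b k * exp (- (real k * t)))"
    and laplace_limit:
      "((\<lambda>t. t powr \<alpha> * (\<Sum>k. b k * exp (- (real k * t)))) \<longlongrightarrow> C) (at_right 0)"
begin

lemma limit_nonneg: "C \<ge> 0"
proof (rule tendsto_lowerbound[OF laplace_limit])
  show "\<forall>\<^sub>F t in at_right 0. 0 \<le> t powr \<alpha> * (\<Sum>k. b k * exp (- (real k * t)))"
    using eventually_at_right_less[of 0]
    by eventually_elim (intro mult_nonneg_nonneg suminf_nonneg summable_laplace, auto simp: coeff_nonneg)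
qed simp

text \<open>
  Applying a test function to \<open>exp (- k * t)\<close> rather than to \<open>k * t\<close> turns a monomial of degree
  \<open>i\<close> into the generating function at \<open>(i + 1) * t\<close> and brings the Weierstrass approximation
  theorem on the compact interval \<open>{0..1}\<close> to bear.
\<close>
definition scaled_sum :: "(real \<Rightarrow> real) \<Rightarrow> real \<Rightarrow> real" where
  "scaled_sum f t = t powr \<alpha> * (\<Sum>k. b k * exp (- (real k * t)) * f (exp (- (real k * t))))"

definition limit_functional :: "(real \<Rightarrow> real) \<Rightarrow> real" where
  "limit_functional f = C / Gamma \<alpha> * (\<integral>x. gamma_kernel \<alpha> x * f (exp (- x)) \<partial>lborel)"

text \<open>
  Each monomial is covered by the hypothesis at a multiple of \<open>t\<close>; its limit agrees with the
  functional by the rescaled Gamma integral.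
\<close>
lemma scaled_sum_tendsto_poly:
  fixes a :: "nat \<Rightarrow> real"
  shows "(scaled_sum (\<lambda>y. \<Sum>i\<le>n. a i * y ^ i) \<longlongrightarrow> limit_functional (\<lambda>y. \<Sum>i\<le>n. a i * y ^ i)) (at_right 0)"
proof -
  define H where "H t = t powr \<alpha> * (\<Sum>k. b k * exp (- (real k * t)))" for t
  have pow: "exp (- u) ^ i = exp (- real i * u)" for u :: real and i
    by (simp add: exp_of_nat_mult[symmetric])
  have int: "has_bochner_integral lborel (\<lambda>x. \<Sum>i\<le>n. a i * (gamma_kernel \<alpha> x * exp (- real i * x)))
      (\<Sum>i\<le>n. a i * (Gamma \<alpha> * (1 + real i) powr (- \<alpha>)))"
    by (intro has_bochner_integral_sum has_bochner_integral_mult_right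
        has_bochner_integral_gamma_kernel_exp exponent_pos) auto
  have "limit_functional (\<lambda>y. \<Sum>i\<le>n. a i * y ^ i)
      = C / Gamma \<alpha> * (\<integral>x. (\<Sum>i\<le>n. a i * (gamma_kernel \<alpha> x * exp (- real i * x))) \<partial>lborel)"
    unfolding limit_functional_def pow sum_distrib_left by (simp add: ac_simps)
  also have "\<dots> = (\<Sum>i\<le>n. a i * ((1 + real i) powr (- \<alpha>) * C))"
    using int Gamma_real_pos[OF exponent_pos]
    by (simp add: has_bochner_integral_iff sum_distrib_left field_simps)
  finally have lim: "limit_functional (\<lambda>y. \<Sum>i\<le>n. a i * y ^ i) = \<dots>" .
  have eq: "scaled_sum (\<lambda>y. \<Sum>i\<le>n. a i * y ^ i) t
      = (\<Sum>i\<le>n. a i * ((1 + real i) powr (- \<alpha>) * H ((1 + real i) * t)))" if t: "t > 0" for t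
  proof -
    have s: "summable (\<lambda>k. b k * exp (- (real k * ((1 + real i) * t))))" for i
      using t by (intro summable_laplace) auto
    have "(\<Sum>k. b k * exp (- (real k * t)) * (\<Sum>i\<le>n. a i * exp (- (real k * t)) ^ i))
        = (\<Sum>k. \<Sum>i\<le>n. a i * (b k * exp (- (real k * ((1 + real i) * t)))))"
      by (intro suminf_cong)
         (auto simp: sum_distrib_left pow ring_distribs exp_add[symmetric] mult_ac intro!: sum.cong)
    also have "\<dots> = (\<Sum>i\<le>n. \<Sum>k. a i * (b k * exp (- (real k * ((1 + real i) * t)))))"
      by (intro suminf_sum summable_mult s)
    also have "\<dots> = (\<Sum>i\<le>n. a i * (\<Sum>k. b k * exp (- (real k * ((1 + real i) * t)))))"
      by (intro sum.cong refl suminf_mult s)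
    finally have series: "(\<Sum>k. b k * exp (- (real k * t)) * (\<Sum>i\<le>n. a i * exp (- (real k * t)) ^ i)) = \<dots>" .
    have "(1 + real i) powr (- \<alpha>) * (((1 + real i) * t) powr \<alpha> * z) = t powr \<alpha> * z" for i z
      using t by (simp add: powr_mult powr_minus)
    then show ?thesis
      unfolding scaled_sum_def series H_def unfolding sum_distrib_left
      by (intro sum.cong refl) (simp only: mult.left_commute[of "t powr \<alpha>"])
  qed
  have "((\<lambda>t. H ((1 + real i) * t)) \<longlongrightarrow> C) (at_right 0)" for i
  proof (rule filterlim_compose[where g = H])
    show "(H \<longlongrightarrow> C) (at_right 0)" using laplace_limit unfolding H_def .
    have "((\<lambda>t. (1 + real i) * t) \<longlongrightarrow> (1 + real i) * 0) (at_right 0)"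
      by (intro tendsto_intros)
    then show "filterlim (\<lambda>t. (1 + real i) * t) (at_right 0) (at_right 0)"
      unfolding filterlim_at using eventually_at_right_less[of 0] by (auto elim!: eventually_mono)
  qed
  then have "((\<lambda>t. \<Sum>i\<le>n. a i * ((1 + real i) powr (- \<alpha>) * H ((1 + real i) * t)))
      \<longlongrightarrow> (\<Sum>i\<le>n. a i * ((1 + real i) powr (- \<alpha>) * C))) (at_right 0)"
    by (intro tendsto_intros)
  then show ?thesis
    unfolding lim
    by (rule Lim_transform_eventually)
       (use eventually_at_right_less[of 0] in \<open>auto elim!: eventually_mono simp: eq\<close>)
qed

lemma summable_scaled_sum:
  assumes "continuous_on UNIV f" "t > 0"
  shows "summable (\<lambda>k. b k * exp (- (real k * t)) * f (exp (- (real k * t))))"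
proof -
  have "compact (f ` {0..1})"
    by (rule compact_continuous_image[OF continuous_on_subset[OF assms(1)]]) auto
  then obtain B where B: "\<And>y. y \<in> {0..1} \<Longrightarrow> norm (f y) \<le> B"
    using compact_imp_bounded bounded_iff by (metis image_eqI)
  show ?thesis
  proof (rule summable_comparison_test'[OF summable_mult2[OF summable_laplace[OF assms(2)], of B]])
    fix k :: nat
    have "norm (f (exp (- (real k * t)))) \<le> B" using assms(2) by (intro B) auto
    then show "norm (b k * exp (- (real k * t)) * f (exp (- (real k * t))))
        \<le> b k * exp (- (real k * t)) * B"
      using coeff_nonneg by (auto simp: abs_mult intro!: mult_left_mono)
  qed
qed

text \<open>
  Both functionals are positive, and their values at the constant \<open>1\<close> are bounded (by \<open>C + 1\<close>
  eventually, and by \<open>C\<close>). A uniform approximation of the test function by a polynomial on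
  \<open>{0..1}\<close> is therefore an approximation of the functionals.
\<close>
lemma scaled_sum_tendsto:
  assumes f: "continuous_on UNIV f"
  shows "(scaled_sum f \<longlongrightarrow> limit_functional f) (at_right 0)"
proof (rule tendstoI)
  fix e :: real assume "e > 0"
  \<comment> \<open>The three errors below add up to \<open>(C + 1) * \<delta> + \<delta> + C * \<delta> = e\<close>.\<close>
  define \<delta> where "\<delta> = e / (2 * C + 2)"
  have \<delta>: "\<delta> > 0" using \<open>e > 0\<close> limit_nonneg by (simp add: \<delta>_def)
  obtain p where p: "real_polynomial_function p" "\<And>y. y \<in> {0..1} \<Longrightarrow> \<bar>f y - p y\<bar> < \<delta>"
    using Stone_Weierstrass_real_polynomial_function[OF compact_Icc continuous_on_subset[OF f] \<delta>]
    by (metis subset_UNIV)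
  obtain a n where poly: "p = (\<lambda>y. \<Sum>i\<le>n. a i * y ^ i)"
    using p(1) by (auto simp: real_polynomial_function_iff_sum)
  have cont_p: "continuous_on UNIV p"
    unfolding poly by (intro continuous_intros)
  have G: "Gamma \<alpha> > 0" using exponent_pos by (rule Gamma_real_pos)
  have "\<bar>(\<integral>x. gamma_kernel \<alpha> x * f (exp (- x)) \<partial>lborel) - (\<integral>x. gamma_kernel \<alpha> x * p (exp (- x)) \<partial>lborel)\<bar>
      = \<bar>\<integral>x. gamma_kernel \<alpha> x * f (exp (- x)) - gamma_kernel \<alpha> x * p (exp (- x)) \<partial>lborel\<bar>"
    by (subst Bochner_Integration.integral_diff)
       (auto intro!: integrable_gamma_kernel_continuous exponent_pos f cont_p)
  also have "\<dots> = norm (\<integral>x. gamma_kernel \<alpha> x * f (exp (- x)) - gamma_kernel \<alpha> x * p (exp (- x)) \<partial>lborel)"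
    by (rule real_norm_def[symmetric])
  also have "\<dots> \<le> (\<integral>x. gamma_kernel \<alpha> x * \<delta> \<partial>lborel)"
  proof (rule Bochner_Integration.integral_norm_bound_integral)
    show "integrable lborel (\<lambda>x. gamma_kernel \<alpha> x * f (exp (- x)) - gamma_kernel \<alpha> x * p (exp (- x)))"
      by (intro Bochner_Integration.integrable_diff integrable_gamma_kernel_continuous exponent_pos f cont_p)
    show "integrable lborel (\<lambda>x. gamma_kernel \<alpha> x * \<delta>)"
      using has_bochner_integral_gamma_kernel[OF exponent_pos] by (auto simp: has_bochner_integral_iff)
    fix x :: real
    show "norm (gamma_kernel \<alpha> x * f (exp (- x)) - gamma_kernel \<alpha> x * p (exp (- x))) \<le> gamma_kernel \<alpha> x * \<delta>"
    proof (cases "x > 0")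
      case True
      then have "\<bar>f (exp (- x)) - p (exp (- x))\<bar> \<le> \<delta>" by (intro less_imp_le p(2)) auto
      then show ?thesis
        using gamma_kernel_nonneg[of \<alpha> x]
        by (auto simp: abs_mult right_diff_distrib[symmetric] intro!: mult_left_mono)
    qed (simp add: gamma_kernel_def)
  qed
  also have "\<dots> = Gamma \<alpha> * \<delta>"
    using has_bochner_integral_gamma_kernel[OF exponent_pos] by (simp add: has_bochner_integral_iff)
  finally have "C / Gamma \<alpha> * \<bar>(\<integral>x. gamma_kernel \<alpha> x * f (exp (- x)) \<partial>lborel)
      - (\<integral>x. gamma_kernel \<alpha> x * p (exp (- x)) \<partial>lborel)\<bar> \<le> C / Gamma \<alpha> * (Gamma \<alpha> * \<delta>)"
    using G limit_nonneg by (intro mult_left_mono) auto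
  then have dist_lim: "\<bar>limit_functional f - limit_functional p\<bar> \<le> C * \<delta>"
    using G limit_nonneg unfolding limit_functional_def right_diff_distrib[symmetric]
    by (simp add: abs_mult)
  have dist_sum: "\<bar>scaled_sum f t - scaled_sum p t\<bar> \<le> (t powr \<alpha> * (\<Sum>k. b k * exp (- (real k * t)))) * \<delta>"
    if t: "t > 0" for t
  proof -
    note s = summable_scaled_sum[OF f t] summable_scaled_sum[OF cont_p t]
    have bound: "norm (b k * exp (- (real k * t)) * f (exp (- (real k * t)))
          - b k * exp (- (real k * t)) * p (exp (- (real k * t)))) \<le> b k * exp (- (real k * t)) * \<delta>" for k
    proof -
      have "\<bar>f (exp (- (real k * t))) - p (exp (- (real k * t)))\<bar> \<le> \<delta>"
        using t by (intro less_imp_le p(2)) auto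
      then show ?thesis
        using coeff_nonneg[of k]
        by (auto simp: abs_mult right_diff_distrib[symmetric] intro!: mult_left_mono)
    qed
    have "\<bar>scaled_sum f t - scaled_sum p t\<bar> = t powr \<alpha> *
        norm (\<Sum>k. b k * exp (- (real k * t)) * f (exp (- (real k * t)))
          - b k * exp (- (real k * t)) * p (exp (- (real k * t))))"
      unfolding scaled_sum_def right_diff_distrib[symmetric] suminf_diff[OF s] by (simp add: abs_mult)
    also have "\<dots> \<le> t powr \<alpha> * (\<Sum>k. b k * exp (- (real k * t)) * \<delta>)"
      by (intro mult_left_mono norm_suminf_le
          summable_mult2 summable_laplace t bound) auto
    also have "\<dots> = (t powr \<alpha> * (\<Sum>k. b k * exp (- (real k * t)))) * \<delta>"
      by (subst suminf_mult2[OF summable_laplace[OF t], symmetric]) simp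
    finally show ?thesis .
  qed
  have "\<forall>\<^sub>F t in at_right 0. t powr \<alpha> * (\<Sum>k. b k * exp (- (real k * t))) < C + 1"
    using laplace_limit by (rule order_tendstoD) auto
  moreover have "\<forall>\<^sub>F t in at_right 0. \<bar>scaled_sum p t - limit_functional p\<bar> < \<delta>"
    using tendstoD[OF scaled_sum_tendsto_poly \<delta>] unfolding poly dist_real_def .
  ultimately show "\<forall>\<^sub>F t in at_right 0. dist (scaled_sum f t) (limit_functional f) < e"
    using eventually_at_right_less[of 0]
  proof eventually_elim
    case (elim t)
    have "\<bar>scaled_sum f t - scaled_sum p t\<bar> \<le> (C + 1) * \<delta>"
      using dist_sum[OF elim(3)] elim(1) \<delta> by (meson less_imp_le mult_right_mono order_trans)
    then have "\<bar>scaled_sum f t - limit_functional f\<bar> < (C + 1) * \<delta> + \<delta> + C * \<delta>"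
      using elim(2) dist_lim by linarith
    also have "\<dots> = \<delta> * (2 * C + 2)" by (simp add: algebra_simps)
    also have "\<dots> = e" using limit_nonneg by (simp add: \<delta>_def)
    finally show ?case by (simp add: dist_real_def)
  qed
qed

lemma summable_ramp:
  assumes "0 < \<epsilon>" "\<epsilon> \<le> 1" "t > 0"
  shows "summable (\<lambda>k. b k * ramp \<epsilon> (real k * t))"
  using summable_scaled_sum[OF continuous_on_ramp_test[OF assms(1)] assms(3)]
  by (simp only: exp_times_ramp_test[OF assms(1,2)])

text \<open>
  It suffices to enclose the limit: it lies between the integrals of the two indicators
  that enclose the ramp, and these agree up to the factor \<open>(1 + \<epsilon>) powr \<alpha>\<close>.
\<close>
lemma ramp_sum_tendsto:
  assumes \<epsilon>: "0 < \<epsilon>" "\<epsilon> \<le> 1"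
  shows "\<exists>L. ((\<lambda>t. t powr \<alpha> * (\<Sum>k. b k * ramp \<epsilon> (real k * t))) \<longlongrightarrow> L) (at_right 0)
    \<and> C / Gamma (\<alpha> + 1) \<le> L \<and> L \<le> C / Gamma (\<alpha> + 1) * (1 + \<epsilon>) powr \<alpha>"
proof -
  let ?f = "ramp_test \<epsilon>"
  note cont = continuous_on_ramp_test[OF \<epsilon>(1)] and f_exp = ramp_test_exp[OF \<epsilon>]
  have sc: "scaled_sum ?f = (\<lambda>t. t powr \<alpha> * (\<Sum>k. b k * ramp \<epsilon> (real k * t)))"
    unfolding scaled_sum_def exp_times_ramp_test[OF \<epsilon>] ..
  have G: "Gamma \<alpha> > 0" "Gamma (\<alpha> + 1) = \<alpha> * Gamma \<alpha>"
    using exponent_pos Gamma_plus1[of \<alpha>] nonpos_Ints_nonpos[of \<alpha>] by (auto simp: Gamma_real_pos)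
  note cut1 = has_bochner_integral_gamma_kernel_cutoff[OF exponent_pos zero_less_one]
  have "1 + \<epsilon> > 0" using \<epsilon> by simp
  note cut2 = has_bochner_integral_gamma_kernel_cutoff[OF exponent_pos this]
  note int = integrable_gamma_kernel_continuous[OF exponent_pos cont, unfolded f_exp]
  have "1 / \<alpha> \<le> (\<integral>x. gamma_kernel \<alpha> x * (exp x * ramp \<epsilon> x) \<partial>lborel)"
  proof -
    have "(\<integral>x. gamma_kernel \<alpha> x * (exp x * indicator {..1} x) \<partial>lborel)
        \<le> (\<integral>x. gamma_kernel \<alpha> x * (exp x * ramp \<epsilon> x) \<partial>lborel)"
      using cut1 int
      by (intro integral_mono mult_left_mono ramp_bounds \<epsilon>)
         (auto simp: gamma_kernel_nonneg has_bochner_integral_iff)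
    then show ?thesis using cut1 by (simp add: has_bochner_integral_iff)
  qed
  then have 1: "C / Gamma (\<alpha> + 1) \<le> limit_functional ?f"
    using mult_left_mono[of "1 / \<alpha>" _ "C / Gamma \<alpha>"] G limit_nonneg
    by (simp add: limit_functional_def f_exp mult.commute[of \<alpha>])
  have "(\<integral>x. gamma_kernel \<alpha> x * (exp x * ramp \<epsilon> x) \<partial>lborel) \<le> (1 + \<epsilon>) powr \<alpha> / \<alpha>"
  proof -
    have "(\<integral>x. gamma_kernel \<alpha> x * (exp x * ramp \<epsilon> x) \<partial>lborel)
        \<le> (\<integral>x. gamma_kernel \<alpha> x * (exp x * indicator {..1 + \<epsilon>} x) \<partial>lborel)"
      using cut2 int
      by (intro integral_mono mult_left_mono ramp_bounds \<epsilon>)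
         (auto simp: gamma_kernel_nonneg has_bochner_integral_iff)
    then show ?thesis using cut2 by (simp add: has_bochner_integral_iff)
  qed
  then have 2: "limit_functional ?f \<le> C / Gamma (\<alpha> + 1) * (1 + \<epsilon>) powr \<alpha>"
    using mult_left_mono[of _ "(1 + \<epsilon>) powr \<alpha> / \<alpha>" "C / Gamma \<alpha>"] G limit_nonneg
    by (simp add: limit_functional_def f_exp mult.commute[of \<alpha>])
  show ?thesis
    using scaled_sum_tendsto[OF cont, unfolded sc] 1 2 by blast
qed

text \<open>
  The ramp dominates the indicator of \<open>{..1}\<close>, so the choice \<open>t = 1 / n\<close> bounds the partial sum
  from above. It vanishes beyond \<open>1 + \<epsilon>\<close>, so the choice \<open>t = (1 + \<epsilon>) / n\<close>, which fits
  its support into the indices up to \<open>n\<close>, bounds the partial sum from below. The two bounds meet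
  as \<open>\<epsilon>\<close> tends to \<open>0\<close>.
\<close>
theorem karamata_partial_sums:
  "(\<lambda>n. (\<Sum>k\<le>n. b k) / real n powr \<alpha>) \<longlonglongrightarrow> C / Gamma (\<alpha> + 1)"
proof -
  define D where "D = C / Gamma (\<alpha> + 1)"
  define S where "S n = (\<Sum>k\<le>n. b k) / real n powr \<alpha>" for n
  have D: "D \<ge> 0"
    using limit_nonneg exponent_pos Gamma_real_pos[of "\<alpha> + 1"] by (simp add: D_def)
  have lim_scale: "filterlim (\<lambda>n. r / real n) (at_right 0) sequentially" if "r > 0" for r :: real
    unfolding filterlim_at
  proof
    show "(\<lambda>n. r / real n) \<longlonglongrightarrow> 0" by (rule lim_const_over_n)
    show "\<forall>\<^sub>F n in sequentially. r / real n \<in> {0<..} \<and> r / real n \<noteq> 0"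
      using eventually_gt_at_top[of 0] by eventually_elim (use that in auto)
  qed
  have upper: "\<forall>\<^sub>F n in sequentially. S n < a"
    if \<epsilon>: "0 < \<epsilon>" "\<epsilon> \<le> 1" and a: "D * (1 + \<epsilon>) powr \<alpha> < a" for \<epsilon> a
  proof -
    obtain L where L: "((\<lambda>t. t powr \<alpha> * (\<Sum>k. b k * ramp \<epsilon> (real k * t))) \<longlongrightarrow> L) (at_right 0)"
      "L \<le> D * (1 + \<epsilon>) powr \<alpha>"
      using ramp_sum_tendsto[OF \<epsilon>] unfolding D_def by blast
    have "(\<lambda>n. (1 / real n) powr \<alpha> * (\<Sum>k. b k * ramp \<epsilon> (real k * (1 / real n)))) \<longlonglongrightarrow> L"
      by (rule filterlim_compose[OF L(1) lim_scale]) simp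
    then have "\<forall>\<^sub>F n in sequentially. (1 / real n) powr \<alpha> * (\<Sum>k. b k * ramp \<epsilon> (real k * (1 / real n))) < a"
      by (rule order_tendstoD(2)) (use L(2) a in simp)
    then show ?thesis
      using eventually_gt_at_top[of 0]
    proof eventually_elim
      case (elim n)
      have s: "summable (\<lambda>k. b k * ramp \<epsilon> (real k * (1 / real n)))"
        using elim by (intro summable_ramp \<epsilon>) auto
      have "(\<Sum>k\<le>n. b k) = (\<Sum>k\<le>n. b k * indicator {..1} (real k * (1 / real n)))"
        using elim by (intro sum.cong) (auto simp: indicator_def field_simps)
      also have "\<dots> \<le> (\<Sum>k\<le>n. b k * ramp \<epsilon> (real k * (1 / real n)))"
        by (intro sum_mono mult_left_mono ramp_bounds \<epsilon> coeff_nonneg)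
      also have "\<dots> \<le> (\<Sum>k. b k * ramp \<epsilon> (real k * (1 / real n)))"
        by (intro sum_le_suminf s) (auto simp: coeff_nonneg ramp_def)
      finally have "S n \<le> (1 / real n) powr \<alpha> * (\<Sum>k. b k * ramp \<epsilon> (real k * (1 / real n)))"
        using elim(2) by (simp add: S_def powr_divide field_simps divide_right_mono)
      then show ?case using elim(1) by simp
    qed
  qed
  have lower: "\<forall>\<^sub>F n in sequentially. a < S n"
    if \<epsilon>: "0 < \<epsilon>" "\<epsilon> \<le> 1" and a: "a * (1 + \<epsilon>) powr \<alpha> < D" for \<epsilon> a
  proof -
    obtain L where L: "((\<lambda>t. t powr \<alpha> * (\<Sum>k. b k * ramp \<epsilon> (real k * t))) \<longlongrightarrow> L) (at_right 0)"
      "D \<le> L"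
      using ramp_sum_tendsto[OF \<epsilon>] unfolding D_def by blast
    have "(\<lambda>n. ((1 + \<epsilon>) / real n) powr \<alpha> * (\<Sum>k. b k * ramp \<epsilon> (real k * ((1 + \<epsilon>) / real n)))) \<longlonglongrightarrow> L"
      by (rule filterlim_compose[OF L(1) lim_scale]) (use \<epsilon> in simp)
    then have "\<forall>\<^sub>F n in sequentially. a * (1 + \<epsilon>) powr \<alpha>
        < ((1 + \<epsilon>) / real n) powr \<alpha> * (\<Sum>k. b k * ramp \<epsilon> (real k * ((1 + \<epsilon>) / real n)))"
      by (rule order_tendstoD(1)) (use L(2) a in simp)
    then show ?thesis
      using eventually_gt_at_top[of 0]
    proof eventually_elim
      case (elim n)
      let ?t = "(1 + \<epsilon>) / real n"
      have "(\<Sum>k. b k * ramp \<epsilon> (real k * ?t)) = (\<Sum>k\<le>n. b k * ramp \<epsilon> (real k * ?t))"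
      proof (rule suminf_finite)
        fix k assume "k \<notin> {..n}"
        then have "real n * (1 + \<epsilon>) < real k * (1 + \<epsilon>)"
          using \<epsilon> by (intro mult_strict_right_mono) auto
        then have "1 + \<epsilon> < real k * ?t" using elim(2) by (simp add: field_simps)
        then show "b k * ramp \<epsilon> (real k * ?t) = 0" using \<epsilon> by (simp add: ramp_def field_simps)
      qed simp
      also have "\<dots> \<le> (\<Sum>k\<le>n. b k * 1)"
        by (intro sum_mono mult_left_mono coeff_nonneg) (auto simp: ramp_def)
      finally have "?t powr \<alpha> * (\<Sum>k. b k * ramp \<epsilon> (real k * ?t)) \<le> ?t powr \<alpha> * (\<Sum>k\<le>n. b k)"
        by (intro mult_left_mono) auto
      also have "\<dots> = S n * (1 + \<epsilon>) powr \<alpha>"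
        using \<epsilon> elim by (simp add: S_def powr_divide)
      finally have "a * (1 + \<epsilon>) powr \<alpha> < S n * (1 + \<epsilon>) powr \<alpha>" using elim by simp
      then show ?case using \<epsilon> by (simp add: mult_less_cancel_right)
    qed
  qed
  have small: "\<exists>\<epsilon>. 0 < \<epsilon> \<and> \<epsilon> \<le> 1 \<and> P \<epsilon>" if "\<forall>\<^sub>F \<epsilon> in at_right 0. P \<epsilon>" for P :: "real \<Rightarrow> bool"
  proof -
    have "\<forall>\<^sub>F \<epsilon> in at_right 0. 0 < \<epsilon> \<and> \<epsilon> \<le> 1 \<and> P \<epsilon>"
      using that eventually_at_right_less[of 0] eventually_at_right_real[of 0 1]
      by (auto elim: eventually_elim2)
    then show ?thesis by (rule eventually_happens'[rotated]) simp
  qed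
  have cont: "((\<lambda>\<epsilon>. a * (1 + \<epsilon>) powr \<alpha>) \<longlongrightarrow> a * (1 + 0) powr \<alpha>) (at_right 0)" for a :: real
    by (intro tendsto_intros) auto
  have "S \<longlonglongrightarrow> D"
  proof (rule order_tendstoI)
    fix a assume "a < D"
    then have "\<forall>\<^sub>F \<epsilon> in at_right 0. a * (1 + \<epsilon>) powr \<alpha> < D"
      by (intro order_tendstoD(2)[OF cont]) auto
    then show "\<forall>\<^sub>F n in sequentially. a < S n" using small lower by blast
  next
    fix a assume "D < a"
    then have "\<forall>\<^sub>F \<epsilon> in at_right 0. D * (1 + \<epsilon>) powr \<alpha> < a"
      by (intro order_tendstoD(2)[OF cont]) auto
    then show "\<forall>\<^sub>F n in sequentially. S n < a" using small upper by blast
  qed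
  then show ?thesis unfolding S_def D_def .
qed

end

section \<open>Generating functions of the hitting times of the range\<close>

text \<open>
  The primitive of \<open>tanh (x / 2)\<close> that vanishes at \<open>0\<close>.
\<close>
definition log_cosh :: "real \<Rightarrow> real" where
  "log_cosh x = 2 * ln (cosh (x / 2))"

lemma log_cosh_0 [simp]: "log_cosh 0 = 0"
  by (simp add: log_cosh_def)

lemma has_real_derivative_log_cosh:
  "(log_cosh has_real_derivative tanh (x / 2)) (at x)"
  unfolding log_cosh_def by (auto intro!: derivative_eq_intros simp: tanh_def)

lemma continuous_on_log_cosh: "continuous_on A log_cosh"
  using has_real_derivative_log_cosh
  by (meson DERIV_continuous continuous_at_imp_continuous_on)

lemma log_cosh_ge: "log_cosh x \<ge> x - 2 * ln 2"
proof -
  have "exp (x / 2) / 2 \<le> cosh (x / 2)" by (simp add: cosh_field_def)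
  then have "ln (exp (x / 2) / 2) \<le> ln (cosh (x / 2))" by (intro ln_mono) auto
  then show ?thesis by (simp add: log_cosh_def ln_div)
qed

text \<open>
  The left-hand side is \<open>cosh (x / 2) powr (- 2 * c)\<close>, the form in which the limit arises; the
  right-hand side is the form in which it enters \<open>J\<close>.
\<close>
lemma exp_log_cosh: "exp (- c * log_cosh x) = 2 powr (2 * c) * (exp x / (exp x + 1)\<^sup>2) powr c"
proof -
  have "cosh (x / 2) = (exp x + 1) / (2 * exp (x / 2))"
    by (simp add: cosh_field_def field_simps flip: exp_add)
  moreover have pos: "exp x + 1 > 0" by (simp add: add_pos_pos)
  ultimately have "ln (cosh (x / 2)) = ln (exp x + 1) - ln 2 - x / 2"
    by (simp add: ln_div ln_mult)
  then have "- c * log_cosh x = 2 * c * ln 2 + c * ln (exp x / (exp x + 1)\<^sup>2)"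
    using pos by (simp add: log_cosh_def ln_div ln_realpow right_diff_distrib)
  then show ?thesis
    using pos by (simp add: powr_def exp_add)
qed

text \<open>
  The mean value theorem. As \<open>tanh\<close> increases, it makes the Riemann sums of \<open>tanh (x / 2)\<close>
  telescope into values of the primitive, from either side.
\<close>
lemma log_cosh_increment:
  assumes "h > 0"
  obtains z where "x < z" "z < x + h" "log_cosh (x + h) - log_cosh x = h * tanh (z / 2)"
  using MVT2[of x "x + h" log_cosh "\<lambda>x. tanh (x / 2)"] has_real_derivative_log_cosh assms
  by auto

lemma sum_tanh_le_log_cosh:
  assumes "\<theta> > 0"
  shows "\<theta> * (\<Sum>j<N. tanh (\<theta> * real j / 2)) \<le> log_cosh (\<theta> * real N)"
proof (induction N)
  case (Suc N)
  obtain z where z: "\<theta> * real N < z" "log_cosh (\<theta> * real N + \<theta>) - log_cosh (\<theta> * real N) = \<theta> * tanh (z / 2)"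
    using log_cosh_increment[OF assms] by metis
  have "\<theta> * tanh (\<theta> * real N / 2) \<le> \<theta> * tanh (z / 2)"
    using assms z by (intro mult_left_mono) auto
  moreover have "\<theta> * real N + \<theta> = \<theta> * real (Suc N)" by (simp add: algebra_simps)
  ultimately show ?case using Suc z(2) by (simp only: sum.lessThan_Suc ring_distribs)
qed simp

lemma log_cosh_le_sum_tanh:
  assumes "\<theta> > 0"
  shows "log_cosh (\<theta> * real N) \<le> \<theta> * (\<Sum>j<Suc N. tanh (\<theta> * real j / 2))"
proof (induction N)
  case (Suc N)
  obtain z where z: "z < \<theta> * real N + \<theta>" "log_cosh (\<theta> * real N + \<theta>) - log_cosh (\<theta> * real N) = \<theta> * tanh (z / 2)"
    using log_cosh_increment[OF assms] by metis
  have eq: "\<theta> * real N + \<theta> = \<theta> * real (Suc N)" by (simp add: algebra_simps)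
  have "\<theta> * tanh (z / 2) \<le> \<theta> * tanh (\<theta> * real (Suc N) / 2)"
    using assms z eq by (intro mult_left_mono) auto
  then show ?case
    using Suc z(2) unfolding eq sum.lessThan_Suc[of _ "Suc N"] by (simp only: ring_distribs)
qed simp

text \<open>
  With \<open>s = 1 / cosh \<theta>\<close>, this is the expectation of \<open>s\<close> to the power of the time that the walk
  needs to increase its range from \<open>j\<close> to \<open>j + 1\<close>. Inside the range the walk is simple and
  symmetric, and the functions \<open>cosh (\<theta> * (y - r))\<close> are multiplied by \<open>cosh \<theta>\<close> under its step; the
  formula is the solution of the first-step equation at an end of the range that is symmetric
  about the midpoint. For \<open>j = 0\<close> it is \<open>s\<close>, in accordance with the first step.
\<close>
definition crossing_gf :: "real \<Rightarrow> real \<Rightarrow> nat \<Rightarrow> real" where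
  "crossing_gf c \<theta> j = 1 / (cosh \<theta> + c * sinh \<theta> * tanh (\<theta> * real j / 2))"

definition hitting_gf :: "real \<Rightarrow> real \<Rightarrow> nat \<Rightarrow> real" where
  "hitting_gf c \<theta> N = (\<Prod>j<N. crossing_gf c \<theta> j)"

lemma
  assumes "c > 0" "\<theta> > 0"
  shows crossing_gf_pos: "crossing_gf c \<theta> j > 0" and crossing_gf_le_1: "crossing_gf c \<theta> j \<le> 1"
proof -
  have "c * sinh \<theta> * tanh (\<theta> * real j / 2) \<ge> 0"
    using assms by simp
  then have "1 \<le> cosh \<theta> + c * sinh \<theta> * tanh (\<theta> * real j / 2)"
    using cosh_real_ge_1[of \<theta>] by linarith
  then show "crossing_gf c \<theta> j > 0" "crossing_gf c \<theta> j \<le> 1"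
    by (auto simp: crossing_gf_def)
qed

lemma hitting_gf_pos: "c > 0 \<Longrightarrow> \<theta> > 0 \<Longrightarrow> hitting_gf c \<theta> N > 0"
  by (auto simp: hitting_gf_def intro!: prod_pos crossing_gf_pos)

text \<open>
  Write the \<open>j\<close>-th factor as \<open>1 / (1 + u j)\<close>. The inequality \<open>1 + u \<le> exp u\<close> turns the product
  into a Riemann sum of \<open>tanh (x / 2)\<close> with mesh \<open>\<theta>\<close>, up to corrections that vanish when \<open>\<theta>\<close>
  tends to \<open>0\<close> with \<open>\<theta> * N\<close> bounded.
\<close>
lemma hitting_gf_lower:
  assumes "c > 0" "\<theta> > 0"
  shows "exp (- (real N * (cosh \<theta> - 1) + c * (sinh \<theta> / \<theta>) * log_cosh (\<theta> * real N))) \<le> hitting_gf c \<theta> N"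
proof -
  define u where "u j = cosh \<theta> - 1 + c * sinh \<theta> * tanh (\<theta> * real j / 2)" for j :: nat
  have u: "u j \<ge> 0" for j
    using assms cosh_real_ge_1[of \<theta>] by (auto simp: u_def intro!: add_nonneg_nonneg)
  have "(\<Sum>j<N. u j) = real N * (cosh \<theta> - 1) + c * (sinh \<theta> / \<theta>) * (\<theta> * (\<Sum>j<N. tanh (\<theta> * real j / 2)))"
    using assms by (simp add: u_def sum.distrib sum_distrib_left mult.assoc)
  also have "\<dots> \<le> real N * (cosh \<theta> - 1) + c * (sinh \<theta> / \<theta>) * log_cosh (\<theta> * real N)"
    using assms by (intro add_left_mono mult_left_mono sum_tanh_le_log_cosh) auto
  finally have "exp (- (real N * (cosh \<theta> - 1) + c * (sinh \<theta> / \<theta>) * log_cosh (\<theta> * real N))) \<le> exp (- (\<Sum>j<N. u j))"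
    by simp
  also have "\<dots> = (\<Prod>j<N. exp (- u j))"
    by (simp add: exp_sum flip: sum_negf)
  also have "\<dots> \<le> (\<Prod>j<N. crossing_gf c \<theta> j)"
  proof (rule prod_mono)
    fix j
    have "1 + u j \<le> exp (u j)" by simp
    then have "1 / exp (u j) \<le> 1 / (1 + u j)" using u[of j] by (intro divide_left_mono) auto
    then show "0 \<le> exp (- u j) \<and> exp (- u j) \<le> crossing_gf c \<theta> j"
      unfolding exp_minus inverse_eq_divide by (simp add: crossing_gf_def u_def)
  qed
  finally show ?thesis by (simp add: hitting_gf_def)
qed

text \<open>
  The factors \<open>1 / (1 + u j)\<close> of \<open>hitting_gf\<close>, as above, satisfy \<open>1 + u j \<le> cosh \<theta> + c * sinh \<theta>\<close>, and dividing by this bound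
  is the price for reversing the inequality \<open>ln (1 + u) \<le> u\<close>. The price tends to \<open>1\<close> with \<open>\<theta>\<close>.
\<close>
definition decay_rate :: "real \<Rightarrow> real \<Rightarrow> real" where
  "decay_rate c \<theta> = c * (sinh \<theta> / \<theta>) / (cosh \<theta> + c * sinh \<theta>)"

lemma decay_rate_pos: "c > 0 \<Longrightarrow> \<theta> > 0 \<Longrightarrow> decay_rate c \<theta> > 0"
  by (simp add: decay_rate_def add_pos_pos)

lemma hitting_gf_upper:
  assumes "c > 0" "\<theta> > 0"
  shows "hitting_gf c \<theta> (Suc N) \<le> exp (- decay_rate c \<theta> * log_cosh (\<theta> * real N))"
proof -
  define u where "u j = cosh \<theta> - 1 + c * sinh \<theta> * tanh (\<theta> * real j / 2)" for j :: nat
  define K where "K = cosh \<theta> + c * sinh \<theta>"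
  have K: "K > 0" using assms by (simp add: K_def add_pos_pos)
  have u: "c * sinh \<theta> * tanh (\<theta> * real j / 2) \<le> u j" "0 \<le> u j" "1 + u j \<le> K" for j
    using assms cosh_real_ge_1[of \<theta>] less_imp_le[OF tanh_real_lt_1[of "\<theta> * real j / 2"]]
    by (auto simp: u_def K_def intro!: add_nonneg_nonneg)
  have "hitting_gf c \<theta> (Suc N) \<le> (\<Prod>j<Suc N. exp (- (c * sinh \<theta> * tanh (\<theta> * real j / 2) / K)))"
    unfolding hitting_gf_def
  proof (rule prod_mono)
    fix j
    have "c * sinh \<theta> * tanh (\<theta> * real j / 2) / K \<le> u j / (1 + u j)"
      using u[of j] K by (intro frac_le) auto
    also have "\<dots> \<le> ln (1 + u j)"
      using ln_add1_ge[OF u(2)[of j]] by (simp add: add.commute)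
    finally have "- ln (1 + u j) \<le> - (c * sinh \<theta> * tanh (\<theta> * real j / 2) / K)" by simp
    then have "exp (- ln (1 + u j)) \<le> exp (- (c * sinh \<theta> * tanh (\<theta> * real j / 2) / K))"
      by (subst exp_le_cancel_iff)
    moreover have "exp (- ln (1 + u j)) = crossing_gf c \<theta> j"
      using u(2)[of j] by (simp add: exp_minus crossing_gf_def u_def field_simps)
    ultimately show "0 \<le> crossing_gf c \<theta> j \<and>
        crossing_gf c \<theta> j \<le> exp (- (c * sinh \<theta> * tanh (\<theta> * real j / 2) / K))"
      using crossing_gf_pos[OF assms, of j] by simp
  qed
  also have "\<dots> = exp (- decay_rate c \<theta> * (\<theta> * (\<Sum>j<Suc N. tanh (\<theta> * real j / 2))))"
    using assms K
    by (subst exp_sum[symmetric])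
       (auto simp: sum_negf decay_rate_def K_def[symmetric] sum_divide_distrib[symmetric]
          sum_distrib_left[symmetric])
  also have "\<dots> \<le> exp (- decay_rate c \<theta> * log_cosh (\<theta> * real N))"
    using log_cosh_le_sum_tanh[OF assms(2), of N] less_imp_le[OF decay_rate_pos[OF assms]]
    by (subst exp_le_cancel_iff) (simp add: mult_left_mono)
  finally show ?thesis .
qed

lemma tendsto_mult_ceiling:
  assumes "x > 0"
  shows "((\<lambda>\<theta>. \<theta> * real (nat \<lceil>x / \<theta>\<rceil>)) \<longlongrightarrow> x) (at_right 0)"
proof (rule tendsto_sandwich)
  have bounds: "x \<le> \<theta> * real (nat \<lceil>x / \<theta>\<rceil>)" "\<theta> * real (nat \<lceil>x / \<theta>\<rceil>) \<le> x + \<theta>"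
    if "\<theta> > 0" for \<theta>
  proof -
    have "x / \<theta> > 0" using that assms by simp
    then have "real (nat \<lceil>x / \<theta>\<rceil>) \<ge> x / \<theta>" "real (nat \<lceil>x / \<theta>\<rceil>) \<le> x / \<theta> + 1"
      by linarith+
    then show "x \<le> \<theta> * real (nat \<lceil>x / \<theta>\<rceil>)" "\<theta> * real (nat \<lceil>x / \<theta>\<rceil>) \<le> x + \<theta>"
      using that by (auto simp: field_simps)
  qed
  show "\<forall>\<^sub>F \<theta> in at_right 0. x \<le> \<theta> * real (nat \<lceil>x / \<theta>\<rceil>)"
    using eventually_at_right_less[of 0] by eventually_elim (rule bounds)
  show "\<forall>\<^sub>F \<theta> in at_right 0. \<theta> * real (nat \<lceil>x / \<theta>\<rceil>) \<le> x + \<theta>"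
    using eventually_at_right_less[of 0] by eventually_elim (rule bounds)
  have "((\<lambda>\<theta>. x + \<theta>) \<longlongrightarrow> x + 0) (at_right 0)" by (intro tendsto_intros)
  then show "((\<lambda>\<theta>. x + \<theta>) \<longlongrightarrow> x) (at_right 0)" by simp
qed simp

lemma sinh_over_tendsto: "((\<lambda>\<theta>::real. sinh \<theta> / \<theta>) \<longlongrightarrow> 1) (at_right 0)"
  unfolding sinh_field_def by real_asymp

lemma cosh_minus_1_over_tendsto: "((\<lambda>\<theta>::real. (cosh \<theta> - 1) / \<theta>) \<longlongrightarrow> 0) (at_right 0)"
  unfolding cosh_field_def by real_asymp

lemma decay_rate_tendsto: "(decay_rate c \<longlongrightarrow> c) (at_right 0)"
proof -
  have "((\<lambda>\<theta>. c * (sinh \<theta> / \<theta>) / (cosh \<theta> + c * sinh \<theta>)) \<longlongrightarrow> c * 1 / (cosh 0 + c * sinh 0)) (at_right 0)"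
    by (intro tendsto_intros sinh_over_tendsto) auto
  then show ?thesis unfolding decay_rate_def by simp
qed

text \<open>
  The lower and the upper bound have the same limit, because \<open>\<theta> * N\<close> tends to \<open>x\<close> and
  \<open>sinh \<theta> / \<theta>\<close> and the decay rate (divided by \<open>c\<close>) tend to \<open>1\<close>. This is the point where the law
  of the hitting times becomes \<open>cosh (x / 2) powr (- 2 * c)\<close> in the limit.
\<close>
lemma hitting_gf_scaling_limit:
  assumes c: "c > 0" and x: "x > 0"
  shows "((\<lambda>\<theta>. hitting_gf c \<theta> (nat \<lceil>x / \<theta>\<rceil>)) \<longlongrightarrow> exp (- c * log_cosh x)) (at_right 0)"
proof (rule tendsto_sandwich)
  let ?N = "\<lambda>\<theta>. nat \<lceil>x / \<theta>\<rceil>"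
  have cont: "(log_cosh \<longlongrightarrow> log_cosh y) (at y)" for y
    using has_real_derivative_log_cosh DERIV_isCont isCont_def by blast
  show "\<forall>\<^sub>F \<theta> in at_right 0. exp (- ((\<theta> * real (?N \<theta>)) * ((cosh \<theta> - 1) / \<theta>)
      + c * (sinh \<theta> / \<theta>) * log_cosh (\<theta> * real (?N \<theta>)))) \<le> hitting_gf c \<theta> (?N \<theta>)"
    using eventually_at_right_less[of 0]
  proof eventually_elim
    case (elim \<theta>)
    then show ?case using hitting_gf_lower[OF c elim, of "?N \<theta>"] by simp
  qed
  have "((\<lambda>\<theta>. exp (- ((\<theta> * real (?N \<theta>)) * ((cosh \<theta> - 1) / \<theta>)
      + c * (sinh \<theta> / \<theta>) * log_cosh (\<theta> * real (?N \<theta>))))) \<longlongrightarrow> exp (- (x * 0 + c * 1 * log_cosh x))) (at_right 0)"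
    by (intro tendsto_intros tendsto_mult_ceiling x sinh_over_tendsto cosh_minus_1_over_tendsto
        tendsto_compose[OF cont tendsto_mult_ceiling[OF x]])
  then show "((\<lambda>\<theta>. exp (- ((\<theta> * real (?N \<theta>)) * ((cosh \<theta> - 1) / \<theta>)
      + c * (sinh \<theta> / \<theta>) * log_cosh (\<theta> * real (?N \<theta>))))) \<longlongrightarrow> exp (- c * log_cosh x)) (at_right 0)"
    by simp
  show "\<forall>\<^sub>F \<theta> in at_right 0. hitting_gf c \<theta> (?N \<theta>)
      \<le> exp (- decay_rate c \<theta> * log_cosh (\<theta> * real (?N \<theta>) - \<theta>))"
    using eventually_at_right_less[of 0]
  proof eventually_elim
    case (elim \<theta>)
    have "?N \<theta> > 0" using elim x by simp
    then obtain K where K: "?N \<theta> = Suc K" using gr0_conv_Suc by blast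
    then show ?case using hitting_gf_upper[OF c elim, of K] by (simp add: algebra_simps)
  qed
  have "((\<lambda>\<theta>. \<theta> * real (?N \<theta>) - \<theta>) \<longlongrightarrow> x - 0) (at_right 0)"
    by (intro tendsto_diff tendsto_mult_ceiling x tendsto_ident_at)
  then have "((\<lambda>\<theta>. exp (- decay_rate c \<theta> * log_cosh (\<theta> * real (?N \<theta>) - \<theta>)))
      \<longlongrightarrow> exp (- c * log_cosh x)) (at_right 0)"
    by (intro tendsto_intros decay_rate_tendsto tendsto_compose[OF cont]) simp
  then show "((\<lambda>\<theta>. exp (- decay_rate c \<theta> * log_cosh (\<theta> * real (?N \<theta>) - \<theta>)))
      \<longlongrightarrow> exp (- c * log_cosh x)) (at_right 0)" .
qed

text \<open>
  \<open>log_cosh\<close> grows linearly. The resulting exponential decay makes the moment integrals converge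
  and dominates them uniformly for small \<open>\<theta>\<close>.
\<close>
lemma hitting_gf_exp_bound:
  assumes "c > 0" "\<theta> > 0" "x > 0"
  shows "hitting_gf c \<theta> (nat \<lceil>x / \<theta>\<rceil>) \<le> exp (- decay_rate c \<theta> * (x - \<theta> - 2 * ln 2))"
proof -
  have p: "x / \<theta> > 0" using assms by simp
  then have "nat \<lceil>x / \<theta>\<rceil> > 0" by simp
  then obtain K where K: "nat \<lceil>x / \<theta>\<rceil> = Suc K" using gr0_conv_Suc by blast
  then have "x / \<theta> - 1 \<le> real K" using p by linarith
  then have "x - \<theta> \<le> \<theta> * real K" using assms by (simp add: field_simps)
  then have "x - \<theta> - 2 * ln 2 \<le> log_cosh (\<theta> * real K)"
    using log_cosh_ge[of "\<theta> * real K"] by linarith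
  then have "exp (- decay_rate c \<theta> * log_cosh (\<theta> * real K)) \<le> exp (- decay_rate c \<theta> * (x - \<theta> - 2 * ln 2))"
    using decay_rate_pos[OF assms(1,2)] by (subst exp_le_cancel_iff) (simp add: mult_left_mono)
  then show ?thesis
    using hitting_gf_upper[OF assms(1,2), of K] unfolding K by (rule order_trans[rotated])
qed

text \<open>
  The derivative of \<open>x ^ l\<close> on the positive half-line.
\<close>
definition moment_kernel :: "nat \<Rightarrow> real \<Rightarrow> real" where
  "moment_kernel l x = indicator {0<..} x * (real l * x ^ (l - 1))"

lemma moment_kernel_nonneg: "moment_kernel l x \<ge> 0"
  by (simp add: moment_kernel_def indicator_def)

lemma moment_kernel_measurable [measurable]: "moment_kernel l \<in> borel_measurable borel"
  unfolding moment_kernel_def by measurable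

lemma integrable_moment_kernel_exp:
  assumes "l \<ge> 1" "\<kappa> > 0"
  shows "integrable lborel (\<lambda>x. moment_kernel l x * exp (- \<kappa> * (x - a)))"
proof -
  have "integrable lborel (\<lambda>x. (real l * exp (\<kappa> * a)) * (gamma_kernel (real l) x * exp (- (\<kappa> - 1) * x)))"
    using has_bochner_integral_gamma_kernel_exp[of "real l" "\<kappa> - 1"] assms
    by (intro integrable_mult_right) (auto simp: has_bochner_integral_iff)
  also have "(\<lambda>x. (real l * exp (\<kappa> * a)) * (gamma_kernel (real l) x * exp (- (\<kappa> - 1) * x)))
      = (\<lambda>x. moment_kernel l x * exp (- \<kappa> * (x - a)))"
  proof
    fix x :: real
    show "(real l * exp (\<kappa> * a)) * (gamma_kernel (real l) x * exp (- (\<kappa> - 1) * x))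
        = moment_kernel l x * exp (- \<kappa> * (x - a))"
    proof (cases "x > 0")
      case True
      have "x powr (real l - 1) = x ^ (l - 1)"
        using True assms(1) by (simp add: powr_realpow[symmetric] of_nat_diff)
      moreover have "exp (\<kappa> * a) * (exp (- x) * exp (- (\<kappa> - 1) * x)) = exp (- \<kappa> * (x - a))"
        by (simp add: algebra_simps flip: exp_add)
      ultimately show ?thesis using True by (simp add: gamma_kernel_def moment_kernel_def)
    qed (simp add: gamma_kernel_def moment_kernel_def)
  qed
  finally show ?thesis .
qed

lemma hitting_gf_ceiling_measurable [measurable]:
  "(\<lambda>x. hitting_gf c \<theta> (nat \<lceil>x / (a::real)\<rceil>)) \<in> borel_measurable borel"
proof -
  have "(\<lambda>x::real. \<lceil>x / a\<rceil>) \<in> borel \<rightarrow>\<^sub>M count_space UNIV"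
    by (rule measurable_compose[OF _ measurable_real_ceiling]) simp
  then show ?thesis
    by (rule measurable_compose[where g = "\<lambda>i. hitting_gf c \<theta> (nat i)"]) simp
qed

lemma J_integral:
  assumes "l \<ge> 1"
  shows "real l * J l c = (\<integral>x. moment_kernel l x * exp (- c * log_cosh x) \<partial>lborel)"
  unfolding J_def set_lebesgue_integral_def exp_log_cosh moment_kernel_def
  by (subst integral_mult_right_zero[symmetric], subst integral_mult_right_zero[symmetric])
     (intro Bochner_Integration.integral_cong refl, simp)

lemma integrable_hitting_gf:
  assumes "c > 0" "l \<ge> 1" "\<theta> > 0"
  shows "integrable lborel (\<lambda>x. moment_kernel l x * hitting_gf c \<theta> (nat \<lceil>x / \<theta>\<rceil>))"
proof (rule Bochner_Integration.integrable_bound)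
  show "integrable lborel (\<lambda>x. moment_kernel l x * exp (- decay_rate c \<theta> * (x - (\<theta> + 2 * ln 2))))"
    by (intro integrable_moment_kernel_exp decay_rate_pos assms)
  show "AE x in lborel. norm (moment_kernel l x * hitting_gf c \<theta> (nat \<lceil>x / \<theta>\<rceil>))
      \<le> norm (moment_kernel l x * exp (- decay_rate c \<theta> * (x - (\<theta> + 2 * ln 2))))"
  proof (rule AE_I2)
    fix x
    show "norm (moment_kernel l x * hitting_gf c \<theta> (nat \<lceil>x / \<theta>\<rceil>))
        \<le> norm (moment_kernel l x * exp (- decay_rate c \<theta> * (x - (\<theta> + 2 * ln 2))))"
    proof (cases "x > 0")
      case True
      then show ?thesis
        using hitting_gf_exp_bound[OF assms(1,3) True] hitting_gf_pos[OF assms(1,3)] moment_kernel_nonneg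
        by (simp add: abs_mult abs_of_pos mult_left_mono diff_diff_eq)
    qed (simp add: moment_kernel_def)
  qed
qed measurable

text \<open>
  Dominated convergence. Once the decay rate lies between \<open>c / 2\<close> and \<open>3 * c / 2\<close>, the
  integrand is below an exponential of rate \<open>c / 2\<close>; the additional constant factor
  \<open>exp (c * (1 + 2 * ln 2))\<close> makes up for the gap between the two rates on the shift
  \<open>1 + 2 * ln 2\<close>.
\<close>
lemma scaled_moment_transform_tendsto:
  assumes c: "c > 0" and l: "l \<ge> 1"
  shows "((\<lambda>\<theta>. \<integral>x. moment_kernel l x * hitting_gf c \<theta> (nat \<lceil>x / \<theta>\<rceil>) \<partial>lborel) \<longlongrightarrow> real l * J l c)
    (at_right 0)"
  unfolding J_integral[OF l] filterlim_at_right_to_top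
proof (rule integral_dominated_convergence_at_top)
  show "(\<lambda>x. moment_kernel l x * exp (- c * log_cosh x)) \<in> borel_measurable lborel"
    using borel_measurable_continuous_onI[OF continuous_on_log_cosh] by measurable
  show "(\<lambda>x. moment_kernel l x * hitting_gf c (inverse t) (nat \<lceil>x / inverse t\<rceil>)) \<in> borel_measurable lborel" for t
    by measurable
  show "integrable lborel (\<lambda>x. moment_kernel l x * exp (- (c / 2) * (x - (1 + 2 * ln 2))) * exp (c * (1 + 2 * ln 2)))"
    using c by (intro integrable_mult_left integrable_moment_kernel_exp l) auto
  show "AE x in lborel. ((\<lambda>t. moment_kernel l x * hitting_gf c (inverse t) (nat \<lceil>x / inverse t\<rceil>))
      \<longlongrightarrow> moment_kernel l x * exp (- c * log_cosh x)) at_top"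
  proof (rule AE_I2)
    fix x
    show "((\<lambda>t. moment_kernel l x * hitting_gf c (inverse t) (nat \<lceil>x / inverse t\<rceil>))
      \<longlongrightarrow> moment_kernel l x * exp (- c * log_cosh x)) at_top"
    proof (cases "x > 0")
      case True
      then show ?thesis
        using hitting_gf_scaling_limit[OF c True]
        unfolding filterlim_at_right_to_top by (intro tendsto_mult_left)
    qed (simp add: moment_kernel_def)
  qed
  have "\<forall>\<^sub>F \<theta> in at_right 0. c / 2 < decay_rate c \<theta>" "\<forall>\<^sub>F \<theta> in at_right 0. decay_rate c \<theta> < 3 * c / 2"
    by (rule order_tendstoD[OF decay_rate_tendsto], use c in simp)+
  then have "\<forall>\<^sub>F \<theta> in at_right 0. AE x in lborel. norm (moment_kernel l x * hitting_gf c \<theta> (nat \<lceil>x / \<theta>\<rceil>))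
      \<le> moment_kernel l x * exp (- (c / 2) * (x - (1 + 2 * ln 2))) * exp (c * (1 + 2 * ln 2))"
    using eventually_at_right_less[of 0] eventually_at_right_real[OF zero_less_one]
  proof eventually_elim
    case (elim \<theta>)
    show ?case
    proof (rule AE_I2)
      fix x
      show "norm (moment_kernel l x * hitting_gf c \<theta> (nat \<lceil>x / \<theta>\<rceil>))
        \<le> moment_kernel l x * exp (- (c / 2) * (x - (1 + 2 * ln 2))) * exp (c * (1 + 2 * ln 2))"
      proof (cases "x > 0")
        case True
        have "decay_rate c \<theta> * (x - \<theta> - 2 * ln 2) \<ge> decay_rate c \<theta> * x - decay_rate c \<theta> * (1 + 2 * ln 2)"
          using elim c by (simp add: algebra_simps)
        moreover have "decay_rate c \<theta> * x \<ge> (c / 2) * x"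
          using elim True by (intro mult_right_mono) auto
        moreover have "decay_rate c \<theta> * (1 + 2 * ln 2) \<le> (3 * c / 2) * (1 + 2 * ln 2)"
          using elim by (intro mult_right_mono) auto
        ultimately have "- decay_rate c \<theta> * (x - \<theta> - 2 * ln 2)
            \<le> - (c / 2) * (x - (1 + 2 * ln 2)) + c * (1 + 2 * ln 2)"
          by (simp add: algebra_simps)
        then have "hitting_gf c \<theta> (nat \<lceil>x / \<theta>\<rceil>) \<le> exp (- (c / 2) * (x - (1 + 2 * ln 2)) + c * (1 + 2 * ln 2))"
          using hitting_gf_exp_bound[OF c elim(3) True] by (meson exp_le_cancel_iff order_trans)
        then show ?thesis
          using hitting_gf_pos[OF c elim(3)] moment_kernel_nonneg
          unfolding exp_add by (simp add: abs_mult abs_of_pos mult_left_mono mult.assoc)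
      qed (simp add: moment_kernel_def)
    qed
  qed
  then show "\<forall>\<^sub>F t in at_top. AE x in lborel. norm (moment_kernel l x * hitting_gf c (inverse t) (nat \<lceil>x / inverse t\<rceil>))
      \<le> moment_kernel l x * exp (- (c / 2) * (x - (1 + 2 * ln 2))) * exp (c * (1 + 2 * ln 2))"
    unfolding eventually_at_right_to_top .
qed

text \<open>
  Below, this turns out to be the generating function at \<open>1 / cosh \<theta>\<close> of the increments in time of
  the \<open>l\<close>-th moment of the range.
\<close>
definition moment_transform :: "real \<Rightarrow> nat \<Rightarrow> real \<Rightarrow> real" where
  "moment_transform c l \<theta> = (\<integral>x. moment_kernel l x * hitting_gf c \<theta> (nat \<lceil>x\<rceil>) \<partial>lborel)"

lemma moment_kernel_scale:
  assumes "l \<ge> 1" "\<theta> > 0"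
  shows "\<theta> * moment_kernel l (\<theta> * x) = \<theta> ^ l * moment_kernel l x"
  using assms power_minus_mult[of l \<theta>]
  by (auto simp: moment_kernel_def indicator_def zero_less_mult_iff power_mult_distrib ac_simps)

lemma integrable_moment_transform:
  assumes "c > 0" "l \<ge> 1" "\<theta> > 0"
  shows "integrable lborel (\<lambda>x. moment_kernel l x * hitting_gf c \<theta> (nat \<lceil>x\<rceil>))"
proof -
  have "integrable lborel (\<lambda>x. moment_kernel l (0 + \<theta> * x) * hitting_gf c \<theta> (nat \<lceil>(0 + \<theta> * x) / \<theta>\<rceil>))"
    using assms by (intro lborel_integrable_real_affine integrable_hitting_gf) auto
  then have "integrable lborel (\<lambda>x. (\<theta> / \<theta> ^ l) * (moment_kernel l (\<theta> * x) * hitting_gf c \<theta> (nat \<lceil>x\<rceil>)))"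
    using assms by simp
  also have "(\<lambda>x. (\<theta> / \<theta> ^ l) * (moment_kernel l (\<theta> * x) * hitting_gf c \<theta> (nat \<lceil>x\<rceil>)))
      = (\<lambda>x. moment_kernel l x * hitting_gf c \<theta> (nat \<lceil>x\<rceil>))"
    using moment_kernel_scale[OF assms(2,3)] assms(3) by (auto simp: fun_eq_iff field_simps)
  finally show ?thesis .
qed

lemma moment_transform_asymptotics:
  assumes c: "c > 0" and l: "l \<ge> 1"
  shows "((\<lambda>\<theta>. \<theta> ^ l * moment_transform c l \<theta>) \<longlongrightarrow> real l * J l c) (at_right 0)"
proof (rule Lim_transform_eventually[OF scaled_moment_transform_tendsto[OF assms]])
  show "\<forall>\<^sub>F \<theta> in at_right 0. (\<integral>x. moment_kernel l x * hitting_gf c \<theta> (nat \<lceil>x / \<theta>\<rceil>) \<partial>lborel)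
      = \<theta> ^ l * moment_transform c l \<theta>"
    using eventually_at_right_less[of 0]
  proof eventually_elim
    case (elim \<theta>)
    have "(\<integral>x. moment_kernel l x * hitting_gf c \<theta> (nat \<lceil>x / \<theta>\<rceil>) \<partial>lborel)
        = (\<integral>x. (\<theta> * moment_kernel l (\<theta> * x)) * hitting_gf c \<theta> (nat \<lceil>x\<rceil>) \<partial>lborel)"
      using elim by (subst lborel_integral_real_affine[of \<theta> _ 0])
        (auto simp: mult.assoc simp flip: integral_mult_right_zero)
    also have "\<dots> = \<theta> ^ l * moment_transform c l \<theta>"
      unfolding moment_kernel_scale[OF l elim] mult.assoc moment_transform_def by simp
    finally show ?case .
  qed
qed

text \<open>
  Positivity of the constant is what allows a limit to be restated as an asymptotic equivalence.
\<close>
lemma J_pos: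
  assumes c: "c > 0" and l: "l \<ge> 1"
  shows "J l c > 0"
proof -
  let ?g = "\<lambda>x. moment_kernel l x * exp (- c * log_cosh x)"
  have int: "integrable lborel ?g"
  proof (rule Bochner_Integration.integrable_bound)
    show "integrable lborel (\<lambda>x. moment_kernel l x * exp (- c * (x - 2 * ln 2)))"
      by (rule integrable_moment_kernel_exp[OF l c])
    show "?g \<in> borel_measurable lborel"
      using borel_measurable_continuous_onI[OF continuous_on_log_cosh] by measurable
    show "AE x in lborel. norm (?g x) \<le> norm (moment_kernel l x * exp (- c * (x - 2 * ln 2)))"
      using c log_cosh_ge moment_kernel_nonneg by (intro AE_I2) (simp add: abs_mult mult_left_mono)
  qed
  have nonneg: "AE x in lborel. 0 \<le> ?g x" by (simp add: moment_kernel_nonneg)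
  have "real l * J l c \<noteq> 0"
  proof
    assume "real l * J l c = 0"
    then have "AE x in lborel. ?g x = 0"
      unfolding J_integral[OF l] using integral_nonneg_eq_0_iff_AE[OF int nonneg] by simp
    then have "AE x in lborel. x \<notin> {0<..<1::real}"
      by eventually_elim (use l in \<open>auto simp: moment_kernel_def\<close>)
    then have "emeasure lborel {0<..<1::real} = 0"
      by (subst (asm) AE_iff_measurable[of "{0<..<1}"]) auto
    then show False by simp
  qed
  moreover have "real l * J l c \<ge> 0"
    unfolding J_integral[OF l] by (intro integral_nonneg_AE nonneg)
  ultimately show ?thesis using l by (auto simp: zero_le_mult_iff order_less_le)
qed

section \<open>The walk seen from the ends of its range\<close>

definition gap_below :: "(nat \<Rightarrow> int) \<Rightarrow> nat \<Rightarrow> nat" where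
  "gap_below x n = nat (x n - path_min x n)"

definition gap_above :: "(nat \<Rightarrow> int) \<Rightarrow> nat \<Rightarrow> nat" where
  "gap_above x n = nat (path_max x n - x n)"

lemma path_max_ge: "x n \<le> path_max x n" and path_min_le: "path_min x n \<le> x n"
  by (auto simp: path_max_def path_min_def intro!: Max_ge Min_le)

lemma path_max_Suc: "path_max x (Suc n) = max (x (Suc n)) (path_max x n)"
  by (simp add: path_max_def atMost_Suc)

lemma path_min_Suc: "path_min x (Suc n) = min (x (Suc n)) (path_min x n)"
  by (simp add: path_min_def atMost_Suc)

lemma path_range_eq_gaps: "path_range x n = int (gap_below x n + gap_above x n)"
  using path_max_ge[of x n] path_min_le[of x n]
  by (simp add: path_range_def gap_below_def gap_above_def)

lemma gaps_0: "gap_below x 0 = 0" "gap_above x 0 = 0"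
  by (simp_all add: gap_below_def gap_above_def path_max_def path_min_def)

text \<open>
  The two gaps alone describe how the range evolves. A step beyond the maximum leaves the gap
  above at \<open>0\<close>, which is exactly what truncated subtraction yields; a step inside the range
  preserves the sum of the gaps. The same holds at the minimum.
\<close>
lemma gaps_up:
  assumes "x (Suc n) = x n + 1"
  shows "gap_below x (Suc n) = gap_below x n + 1" "gap_above x (Suc n) = gap_above x n - 1"
  using path_max_ge[of x n] path_min_le[of x n] assms
  by (auto simp: gap_below_def gap_above_def path_max_Suc path_min_Suc)

lemma gaps_down:
  assumes "x (Suc n) = x n - 1"
  shows "gap_below x (Suc n) = gap_below x n - 1" "gap_above x (Suc n) = gap_above x n + 1"
  using path_max_ge[of x n] path_min_le[of x n] assms
  by (auto simp: gap_below_def gap_above_def path_max_Suc path_min_Suc)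

lemma path_range_mono: "path_range x n \<le> path_range x (Suc n)"
  by (auto simp: path_range_def path_max_Suc path_min_Suc)

definition up_prob :: "real \<Rightarrow> nat \<times> nat \<Rightarrow> real" where
  "up_prob c = (\<lambda>(a, b). if a + b = 0 then 1 / 2 else if b = 0 then 1 / (1 + c)
     else if a = 0 then c / (1 + c) else 1 / 2)"

lemma orrw_up_prob_eq: "orrw_up_prob c x n = up_prob c (gap_below x n, gap_above x n)"
  using path_max_ge[of x n] path_min_le[of x n]
  by (auto simp: orrw_up_prob_def up_prob_def gap_below_def gap_above_def)

lemma up_prob_bounds:
  assumes "c > 0"
  shows "0 \<le> up_prob c s" "up_prob c s \<le> 1"
  using assms by (auto simp: up_prob_def split: prod.splits)

definition up_move :: "nat \<times> nat \<Rightarrow> nat \<times> nat" where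
  "up_move = (\<lambda>(a, b). (a + 1, b - 1))"

definition down_move :: "nat \<times> nat \<Rightarrow> nat \<times> nat" where
  "down_move = (\<lambda>(a, b). (a - 1, b + 1))"

text \<open>
  The transition operator of the Markov chain formed by the two gaps.
\<close>
definition step_mean :: "real \<Rightarrow> (nat \<times> nat \<Rightarrow> real) \<Rightarrow> nat \<times> nat \<Rightarrow> real" where
  "step_mean c f s = up_prob c s * f (up_move s) + (1 - up_prob c s) * f (down_move s)"

text \<open>
  For \<open>a + b < N\<close>, the expectation of \<open>1 / cosh \<theta>\<close> to the power of the remaining time until the
  range reaches \<open>N\<close>, for a walk whose gaps are \<open>a\<close> and \<open>b\<close>. The product is its value at an end of
  the range; the ratio of hyperbolic cosines, of the distances to the midpoint of the range,
  compares the current position with an end.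
\<close>
definition discounted_weight :: "real \<Rightarrow> real \<Rightarrow> nat \<Rightarrow> nat \<times> nat \<Rightarrow> real" where
  "discounted_weight c \<theta> N = (\<lambda>(a, b).
     cosh (\<theta> * (real a - real b) / 2) / cosh (\<theta> * (real a + real b) / 2)
       * (\<Prod>j\<in>{a + b..<N}. crossing_gf c \<theta> j))"

text \<open>
  Together with the factor \<open>(1 / cosh \<theta>) ^ n\<close>, the weight is a martingale until the range
  reaches \<open>N\<close>. In the interior this is the addition theorem for \<open>cosh\<close>; at an end it is the
  equation that determines \<open>crossing_gf\<close>; at the starting point both neighbours are new.
\<close>
lemma step_mean_discounted_weight:
  assumes c: "c > 0" and less: "a + b < N"
  shows "step_mean c (discounted_weight c \<theta> N) (a, b) = cosh \<theta> * discounted_weight c \<theta> N (a, b)"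
proof -
  define P where "P = (\<Prod>j\<in>{Suc (a + b)..<N}. crossing_gf c \<theta> j)"
  have P: "(\<Prod>j\<in>{a + b..<N}. crossing_gf c \<theta> j) = crossing_gf c \<theta> (a + b) * P"
    using less unfolding P_def by (subst prod.atLeast_Suc_lessThan) auto
  \<comment> \<open>The first-step equation at an end: with weight \<open>1\<close> the walk steps out, with weight \<open>c\<close> in.\<close>
  have edge: "1 / (1 + c) + c / (1 + c) * (cosh (\<theta> * real r / 2 - \<theta>) / cosh (\<theta> * real r / 2) * crossing_gf c \<theta> r)
      = cosh \<theta> * crossing_gf c \<theta> r"
    if "cosh \<theta> + c * sinh \<theta> * tanh (\<theta> * real r / 2) \<noteq> 0" for r :: nat
  proof -
    define D where "D = cosh \<theta> + c * sinh \<theta> * tanh (\<theta> * real r / 2)"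
    have "cosh (\<theta> * real r / 2 - \<theta>) / cosh (\<theta> * real r / 2) = cosh \<theta> - tanh (\<theta> * real r / 2) * sinh \<theta>"
      unfolding cosh_diff by (simp add: tanh_def diff_divide_distrib)
    moreover have "crossing_gf c \<theta> r = 1 / D" "D \<noteq> 0"
      using that by (auto simp: crossing_gf_def D_def)
    moreover have "1 / (1 + c) + c / (1 + c) * ((cosh \<theta> - tanh (\<theta> * real r / 2) * sinh \<theta>) * (1 / D))
        = (D + c * (cosh \<theta> - tanh (\<theta> * real r / 2) * sinh \<theta>)) / ((1 + c) * D)"
      unfolding add_divide_distrib using c \<open>D \<noteq> 0\<close> by simp
    moreover have "D + c * (cosh \<theta> - tanh (\<theta> * real r / 2) * sinh \<theta>) = (1 + c) * cosh \<theta>"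
      by (simp add: D_def algebra_simps)
    ultimately show ?thesis using c by simp
  qed
  have D_nz: "cosh \<theta> + c * sinh \<theta> * tanh (\<theta> * real r / 2) \<noteq> 0" for r :: nat
  proof -
    have "sinh \<theta> * tanh (\<theta> * real r / 2) \<ge> 0"
      by (cases "\<theta> \<ge> 0") (auto simp: zero_le_mult_iff mult_le_0_iff)
    then show ?thesis using c cosh_real_pos[of \<theta>]
      by (smt (verit) mult.assoc mult_nonneg_nonneg)
  qed
  consider "a = 0" "b = 0" | "a > 0" "b = 0" | "a = 0" "b > 0" | "a > 0" "b > 0" by blast
  then show ?thesis
  proof cases
    case 1
    then show ?thesis
      using P by (simp add: step_mean_def up_prob_def up_move_def down_move_def discounted_weight_def
          crossing_gf_def P_def)
  next
    case 2
    have up: "discounted_weight c \<theta> N (a + 1, 0) = P"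
      by (simp add: discounted_weight_def P_def 2)
    have down: "discounted_weight c \<theta> N (a - 1, 1)
        = cosh (\<theta> * real a / 2 - \<theta>) / cosh (\<theta> * real a / 2) * crossing_gf c \<theta> a * P"
    proof -
      have "\<theta> * (real (a - 1) - real 1) / 2 = \<theta> * real a / 2 - \<theta>" "real (a - 1) + real 1 = real a" "a - 1 + 1 = a"
        using 2 by (auto simp: of_nat_diff field_simps)
      then show ?thesis using 2 P unfolding discounted_weight_def prod.case by (simp only:) simp
    qed
    have here: "discounted_weight c \<theta> N (a, 0) = crossing_gf c \<theta> a * P"
      using 2 P by (simp add: discounted_weight_def)
    have "step_mean c (discounted_weight c \<theta> N) (a, b)
        = (1 / (1 + c)) * P + (1 - 1 / (1 + c)) * (cosh (\<theta> * real a / 2 - \<theta>) / cosh (\<theta> * real a / 2) * crossing_gf c \<theta> a * P)"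
      using 2 up down by (simp add: step_mean_def up_prob_def up_move_def down_move_def)
    also have "1 - 1 / (1 + c) = c / (1 + c)" using c by (simp add: field_simps)
    finally show ?thesis
      using edge[OF D_nz, of a] here 2 by (simp only: distrib_right[symmetric] mult.assoc[symmetric])
  next
    case 3
    have down: "discounted_weight c \<theta> N (0, b + 1) = P"
      using cosh_minus[of "\<theta> * (1 + real b) / 2"] by (simp add: discounted_weight_def P_def 3)
    have up: "discounted_weight c \<theta> N (1, b - 1)
        = cosh (\<theta> * real b / 2 - \<theta>) / cosh (\<theta> * real b / 2) * crossing_gf c \<theta> b * P"
    proof -
      have "\<theta> * (real 1 - real (b - 1)) / 2 = - (\<theta> * real b / 2 - \<theta>)" "real 1 + real (b - 1) = real b" "1 + (b - 1) = b"
        using 3 by (auto simp: of_nat_diff field_simps)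
      then show ?thesis using 3 P unfolding discounted_weight_def prod.case by (simp only: cosh_minus) simp
    qed
    have here: "discounted_weight c \<theta> N (0, b) = crossing_gf c \<theta> b * P"
      using 3 P by (simp add: discounted_weight_def)
    have "step_mean c (discounted_weight c \<theta> N) (a, b)
        = c / (1 + c) * (cosh (\<theta> * real b / 2 - \<theta>) / cosh (\<theta> * real b / 2) * crossing_gf c \<theta> b * P) + (1 - c / (1 + c)) * P"
      using 3 up down by (simp add: step_mean_def up_prob_def up_move_def down_move_def)
    also have "1 - c / (1 + c) = 1 / (1 + c)" using c by (simp add: field_simps)
    finally show ?thesis
      using edge[OF D_nz, of b] here 3
      by (simp only: distrib_right[symmetric] mult.assoc[symmetric] add.commute[of "c / _ * _ * _ * _"]) simp
  next
    case 4
    let ?d = "\<theta> * (real a - real b) / 2"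
    have up: "discounted_weight c \<theta> N (a + 1, b - 1)
        = cosh (?d + \<theta>) / cosh (\<theta> * (real a + real b) / 2) * (\<Prod>j\<in>{a + b..<N}. crossing_gf c \<theta> j)"
    proof -
      have "\<theta> * (real (a + 1) - real (b - 1)) / 2 = ?d + \<theta>" "real (a + 1) + real (b - 1) = real a + real b"
        "a + 1 + (b - 1) = a + b"
        using 4 by (auto simp: of_nat_diff field_simps)
      then show ?thesis unfolding discounted_weight_def prod.case by metis
    qed
    have down: "discounted_weight c \<theta> N (a - 1, b + 1)
        = cosh (?d - \<theta>) / cosh (\<theta> * (real a + real b) / 2) * (\<Prod>j\<in>{a + b..<N}. crossing_gf c \<theta> j)"
    proof -
      have "\<theta> * (real (a - 1) - real (b + 1)) / 2 = ?d - \<theta>" "real (a - 1) + real (b + 1) = real a + real b"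
        "a - 1 + (b + 1) = a + b"
        using 4 by (auto simp: of_nat_diff field_simps)
      then show ?thesis unfolding discounted_weight_def prod.case by metis
    qed
    have "step_mean c (discounted_weight c \<theta> N) (a, b)
        = (cosh (?d + \<theta>) + cosh (?d - \<theta>)) / 2 / cosh (\<theta> * (real a + real b) / 2) * (\<Prod>j\<in>{a + b..<N}. crossing_gf c \<theta> j)"
      using 4 up down by (simp add: step_mean_def up_prob_def up_move_def down_move_def field_simps)
    also have "(cosh (?d + \<theta>) + cosh (?d - \<theta>)) / 2 = cosh \<theta> * cosh ?d"
      by (simp add: cosh_add cosh_diff)
    finally show ?thesis by (simp add: discounted_weight_def)
  qed
qed

lemma discounted_weight_bounds:
  assumes "c > 0" "\<theta> > 0"
  shows "0 \<le> discounted_weight c \<theta> N s" "discounted_weight c \<theta> N s \<le> 1"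
proof -
  obtain a b where s: "s = (a, b)" by (cases s)
  have "\<bar>\<theta> * (real a - real b) / 2\<bar> \<le> \<theta> * (real a + real b) / 2"
    using assms by (auto simp: abs_mult intro!: mult_left_mono)
  then have "cosh (\<theta> * (real a - real b) / 2) \<le> cosh (\<theta> * (real a + real b) / 2)"
    using cosh_real_nonneg_le_iff[of "\<bar>\<theta> * (real a - real b) / 2\<bar>" "\<theta> * (real a + real b) / 2"] assms
    unfolding cosh_real_abs by simp
  then have ratio: "cosh (\<theta> * (real a - real b) / 2) / cosh (\<theta> * (real a + real b) / 2) \<le> 1"
    by simp
  have prod: "0 \<le> (\<Prod>j\<in>{a + b..<N}. crossing_gf c \<theta> j)" "(\<Prod>j\<in>{a + b..<N}. crossing_gf c \<theta> j) \<le> 1"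
    by (intro prod_nonneg prod_le_1 conjI ballI less_imp_le crossing_gf_pos crossing_gf_le_1 assms)+
  show "0 \<le> discounted_weight c \<theta> N s"
    using prod by (simp add: s discounted_weight_def)
  show "discounted_weight c \<theta> N s \<le> 1"
    using mult_mono[OF ratio prod(2)] prod(1) by (simp add: s discounted_weight_def)
qed

text \<open>
  Since the range grows by at most one per step, it reaches \<open>N\<close> at an end of an interval of length
  \<open>N\<close>, where the discounted weight equals \<open>1\<close>. Freezing the weight at \<open>1\<close> from then on gives a
  bounded function on all states and replaces the stopping time by indicators.
\<close>
definition stopped_weight :: "real \<Rightarrow> real \<Rightarrow> nat \<Rightarrow> nat \<times> nat \<Rightarrow> real" where
  "stopped_weight c \<theta> N s = (if fst s + snd s < N then discounted_weight c \<theta> N s else 1)"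

lemma discounted_weight_edge: "discounted_weight c \<theta> N (a, 0) = (\<Prod>j\<in>{a..<N}. crossing_gf c \<theta> j)"
  "discounted_weight c \<theta> N (0, b) = (\<Prod>j\<in>{b..<N}. crossing_gf c \<theta> j)"
  by (auto simp: discounted_weight_def)

lemma step_mean_stopped_weight:
  assumes "c > 0"
  shows "step_mean c (stopped_weight c \<theta> N) s =
    (if fst s + snd s < N then cosh \<theta> * discounted_weight c \<theta> N s else 1)"
proof -
  obtain a b where s: "s = (a, b)" by (cases s)
  show ?thesis
  proof (cases "a + b < N")
    case True
    have "stopped_weight c \<theta> N (up_move s) = discounted_weight c \<theta> N (up_move s)"
      using True by (cases "b = 0") (auto simp: s stopped_weight_def up_move_def discounted_weight_edge)
    moreover have "stopped_weight c \<theta> N (down_move s) = discounted_weight c \<theta> N (down_move s)"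
      using True by (cases "a = 0") (auto simp: s stopped_weight_def down_move_def discounted_weight_edge)
    ultimately show ?thesis
      using True step_mean_discounted_weight[OF assms True] by (simp add: s step_mean_def)
  next
    case False
    then show ?thesis
      by (auto simp: s step_mean_def stopped_weight_def up_move_def down_move_def)
  qed
qed

text \<open>
  Elementary conditional probabilities given the value of a discrete variable determine
  expectations: the two sides are integrals against measures on a countable space that agree on
  all singletons.
\<close>
lemma nn_integral_event_conditional:
  fixes H :: "'a \<Rightarrow> 'h :: countable" and u :: "'h \<Rightarrow> ennreal"
  assumes [measurable]: "H \<in> M \<rightarrow>\<^sub>M count_space UNIV" "D \<in> sets M"
    and cond: "\<And>h. emeasure M (D \<inter> (H -` {h} \<inter> space M)) = u h * emeasure M (H -` {h} \<inter> space M)"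
  shows "(\<integral>\<^sup>+\<omega>. g (H \<omega>) * indicator D \<omega> \<partial>M) = (\<integral>\<^sup>+\<omega>. g (H \<omega>) * u (H \<omega>) \<partial>M)"
proof -
  have [measurable]: "(\<lambda>\<omega>. f (H \<omega>)) \<in> borel_measurable M" for f :: "'h \<Rightarrow> ennreal"
    by (rule measurable_compose[OF assms(1)]) simp
  have [measurable]: "H -` {h} \<inter> space M \<in> sets M" for h
    using measurable_sets[OF assms(1), of "{h}"] by simp
  let ?N1 = "distr (density M (indicator D)) (count_space UNIV) H"
  let ?N2 = "distr (density M (\<lambda>\<omega>. u (H \<omega>))) (count_space UNIV) H"
  have "?N1 = ?N2"
  proof (rule measure_eqI_countable[where A = UNIV])
    fix h
    have "emeasure ?N1 {h} = emeasure M (D \<inter> (H -` {h} \<inter> space M))"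
      by (simp add: emeasure_distr emeasure_density flip: indicator_inter_arith)
    also have "\<dots> = (\<integral>\<^sup>+\<omega>. u h * indicator (H -` {h} \<inter> space M) \<omega> \<partial>M)"
      by (simp add: cond nn_integral_cmult_indicator)
    also have "\<dots> = (\<integral>\<^sup>+\<omega>. u (H \<omega>) * indicator (H -` {h} \<inter> space M) \<omega> \<partial>M)"
      by (intro nn_integral_cong) (auto simp: indicator_def)
    also have "\<dots> = emeasure ?N2 {h}"
      by (simp add: emeasure_distr emeasure_density)
    finally show "emeasure ?N1 {h} = emeasure ?N2 {h}" .
  qed auto
  then have "(\<integral>\<^sup>+h. g h \<partial>?N1) = (\<integral>\<^sup>+h. g h \<partial>?N2)" by simp
  then show ?thesis
    by (simp add: nn_integral_distr nn_integral_density mult.commute)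
qed

context once_reinforced_random_walk
begin

definition history :: "nat \<Rightarrow> 'a \<Rightarrow> int list" where
  "history n \<omega> = map (\<lambda>k. X k \<omega>) [0..<Suc n]"

definition gaps :: "nat \<Rightarrow> 'a \<Rightarrow> nat \<times> nat" where
  "gaps n \<omega> = (gap_below (\<lambda>k. X k \<omega>) n, gap_above (\<lambda>k. X k \<omega>) n)"

declare measurable_walk [measurable]

lemma history_eq_iff: "history n \<omega> = h \<longleftrightarrow> length h = Suc n \<and> (\<forall>k\<le>n. X k \<omega> = h ! k)"
  by (auto simp: history_def list_eq_iff_nth_eq less_Suc_eq_le simp del: upt_Suc)

lemma history_measurable [measurable]: "history n \<in> M \<rightarrow>\<^sub>M count_space UNIV"
  unfolding measurable_count_space_eq2_countable
proof (intro conjI ballI)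
  fix h :: "int list"
  have "history n -` {h} \<inter> space M = (if length h = Suc n then {\<omega> \<in> space M. \<forall>k\<in>{..n}. X k \<omega> = h ! k} else {})"
    using history_eq_iff[of n _ h] by auto
  moreover have "{\<omega> \<in> space M. \<forall>k\<in>{..n}. X k \<omega> = h ! k} \<in> sets M" by measurable
  ultimately show "history n -` {h} \<inter> space M \<in> sets M" by simp
qed simp

lemma gaps_history:
  "gaps n \<omega> = (gap_below ((!) (history n \<omega>)) n, gap_above ((!) (history n \<omega>)) n)"
proof -
  have "history n \<omega> ! k = X k \<omega>" if "k \<le> n" for k
    using that by (auto simp: history_def less_Suc_eq_le simp del: upt_Suc)
  then have "(!) (history n \<omega>) ` {..n} = (\<lambda>k. X k \<omega>) ` {..n}" "history n \<omega> ! n = X n \<omega>"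
    by (auto simp: image_iff)
  then show ?thesis
    by (simp add: gaps_def gap_below_def gap_above_def path_max_def path_min_def)
qed

lemma gaps_measurable [measurable]: "gaps n \<in> M \<rightarrow>\<^sub>M count_space UNIV"
proof -
  have "gaps n = (\<lambda>\<omega>. (\<lambda>h. (gap_below ((!) h) n, gap_above ((!) h) n)) (history n \<omega>))"
    by (rule ext) (rule gaps_history)
  also have "\<dots> \<in> M \<rightarrow>\<^sub>M count_space UNIV"
    by (rule measurable_compose[OF history_measurable]) simp
  finally show ?thesis .
qed

text \<open>
  The passage from histories to gaps: the conditional probability of a step depends on the history
  only through the gaps, and so only the gaps appear as arguments of the test function. Histories of
  probability zero contribute nothing on either side.
\<close>
lemma nn_integral_next_step:
  assumes D [measurable]: "Measurable.pred M D" and q: "\<And>s. 0 \<le> q s"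
    and cond: "\<And>x. \<P>(\<omega> in M. \<forall>k\<le>n. X k \<omega> = x k) > 0 \<Longrightarrow>
      \<P>(\<omega> in M. D \<omega> \<bar> \<forall>k\<le>n. X k \<omega> = x k) = q (gap_below x n, gap_above x n)"
  shows "(\<integral>\<^sup>+\<omega>. f (gaps n \<omega>) * indicator {\<omega> \<in> space M. D \<omega>} \<omega> \<partial>M)
    = (\<integral>\<^sup>+\<omega>. f (gaps n \<omega>) * ennreal (q (gaps n \<omega>)) \<partial>M)"
proof -
  let ?gaps_of = "\<lambda>h::int list. (gap_below ((!) h) n, gap_above ((!) h) n)"
  have "(\<integral>\<^sup>+\<omega>. f (?gaps_of (history n \<omega>)) * indicator {\<omega> \<in> space M. D \<omega>} \<omega> \<partial>M)
    = (\<integral>\<^sup>+\<omega>. f (?gaps_of (history n \<omega>)) * ennreal (q (?gaps_of (history n \<omega>))) \<partial>M)"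
  proof (rule nn_integral_event_conditional[where g = "\<lambda>h. f (?gaps_of h)" and u = "\<lambda>h. ennreal (q (?gaps_of h))"
        and H = "history n" and D = "{\<omega> \<in> space M. D \<omega>}"])
    show "history n \<in> M \<rightarrow>\<^sub>M count_space UNIV" by measurable
    show "{\<omega> \<in> space M. D \<omega>} \<in> sets M" by measurable
    fix h :: "int list"
    show "emeasure M ({\<omega> \<in> space M. D \<omega>} \<inter> (history n -` {h} \<inter> space M))
      = ennreal (q (?gaps_of h)) * emeasure M (history n -` {h} \<inter> space M)"
    proof (cases "length h = Suc n")
      case False
      then have "history n -` {h} \<inter> space M = {}" using history_eq_iff[of n _ h] by auto
      then show ?thesis by simp
    next
      case True
      let ?E = "{\<omega> \<in> space M. \<forall>k\<le>n. X k \<omega> = h ! k}"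
      have E: "history n -` {h} \<inter> space M = ?E" using history_eq_iff[of n _ h] True by auto
      have [measurable]: "?E \<in> sets M"
        using measurable_sets[OF history_measurable, of "{h}" n] by (simp add: E)
      have DE: "{\<omega> \<in> space M. D \<omega>} \<inter> ?E = {\<omega> \<in> space M. D \<omega> \<and> (\<forall>k\<le>n. X k \<omega> = h ! k)}" by auto
      show ?thesis
      proof (cases "prob ?E > 0")
        case True
        then have "prob ({\<omega> \<in> space M. D \<omega>} \<inter> ?E) = q (?gaps_of h) * prob ?E"
          using cond[OF True] by (simp add: cond_prob_def DE field_simps)
        then show ?thesis
          unfolding E by (simp add: emeasure_eq_measure ennreal_mult q)
      next
        case False
        then have "emeasure M ?E = 0"
          using measure_nonneg[of M ?E] by (simp add: emeasure_eq_measure)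
        moreover have "emeasure M ({\<omega> \<in> space M. D \<omega>} \<inter> ?E) \<le> emeasure M ?E"
          by (intro emeasure_mono) auto
        ultimately show ?thesis unfolding E by simp
      qed
    qed
  qed
  then show ?thesis by (simp flip: gaps_history)
qed

lemma borel_measurable_gaps [measurable]:
  fixes f :: "nat \<times> nat \<Rightarrow> 'b :: topological_space"
  shows "(\<lambda>\<omega>. f (gaps n \<omega>)) \<in> borel_measurable M"
  by (rule measurable_compose[OF gaps_measurable]) simp

lemma
  assumes "c > 0"
  shows nn_integral_up_step:
      "(\<integral>\<^sup>+\<omega>. f (gaps n \<omega>) * indicator {\<omega> \<in> space M. X (Suc n) \<omega> = X n \<omega> + 1} \<omega> \<partial>M)
        = (\<integral>\<^sup>+\<omega>. f (gaps n \<omega>) * ennreal (up_prob c (gaps n \<omega>)) \<partial>M)"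
    and nn_integral_down_step:
      "(\<integral>\<^sup>+\<omega>. f (gaps n \<omega>) * indicator {\<omega> \<in> space M. X (Suc n) \<omega> = X n \<omega> - 1} \<omega> \<partial>M)
        = (\<integral>\<^sup>+\<omega>. f (gaps n \<omega>) * ennreal (1 - up_prob c (gaps n \<omega>)) \<partial>M)"
proof -
  show "(\<integral>\<^sup>+\<omega>. f (gaps n \<omega>) * indicator {\<omega> \<in> space M. X (Suc n) \<omega> = X n \<omega> + 1} \<omega> \<partial>M)
        = (\<integral>\<^sup>+\<omega>. f (gaps n \<omega>) * ennreal (up_prob c (gaps n \<omega>)) \<partial>M)"
    by (rule nn_integral_next_step) (use step_up up_prob_bounds[OF assms] in \<open>auto simp: orrw_up_prob_eq\<close>)
  show "(\<integral>\<^sup>+\<omega>. f (gaps n \<omega>) * indicator {\<omega> \<in> space M. X (Suc n) \<omega> = X n \<omega> - 1} \<omega> \<partial>M)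
        = (\<integral>\<^sup>+\<omega>. f (gaps n \<omega>) * ennreal (1 - up_prob c (gaps n \<omega>)) \<partial>M)"
    by (rule nn_integral_next_step[where q = "\<lambda>s. 1 - up_prob c s"])
       (use step_down up_prob_bounds[OF assms] in \<open>auto simp: orrw_up_prob_eq\<close>)
qed

text \<open>
  The conditional probabilities of the two steps add up to \<open>1\<close>, so no other step has positive
  probability.
\<close>
lemma AE_up_or_down:
  assumes "c > 0"
  shows "AE \<omega> in M. X (Suc n) \<omega> = X n \<omega> + 1 \<or> X (Suc n) \<omega> = X n \<omega> - 1"
proof -
  let ?U = "{\<omega> \<in> space M. X (Suc n) \<omega> = X n \<omega> + 1}" and ?D = "{\<omega> \<in> space M. X (Suc n) \<omega> = X n \<omega> - 1}"
  have [measurable]: "?U \<in> sets M" "?D \<in> sets M" by measurable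
  have "emeasure M (?U \<union> ?D) = emeasure M ?U + emeasure M ?D"
    by (subst plus_emeasure) auto
  also have "\<dots> = (\<integral>\<^sup>+\<omega>. ennreal (up_prob c (gaps n \<omega>)) \<partial>M) + (\<integral>\<^sup>+\<omega>. ennreal (1 - up_prob c (gaps n \<omega>)) \<partial>M)"
    using nn_integral_up_step[OF assms, of "\<lambda>_. 1" n] nn_integral_down_step[OF assms, of "\<lambda>_. 1" n] by simp
  also have "\<dots> = (\<integral>\<^sup>+\<omega>. ennreal (up_prob c (gaps n \<omega>)) + ennreal (1 - up_prob c (gaps n \<omega>)) \<partial>M)"
    by (rule nn_integral_add[symmetric]) measurable
  also have "\<dots> = (\<integral>\<^sup>+\<omega>. 1 \<partial>M)"
    using up_prob_bounds[OF assms] by (intro nn_integral_cong) (simp flip: ennreal_plus)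
  also have "\<dots> = 1" by (simp add: emeasure_space_1)
  finally have "prob (?U \<union> ?D) = 1" by (simp add: emeasure_eq_measure)
  then have "AE \<omega> in M. \<omega> \<in> ?U \<union> ?D" by (subst (asm) prob_eq_1) auto
  then show ?thesis by eventually_elim auto
qed

lemma gaps_next:
  "X (Suc n) \<omega> = X n \<omega> + 1 \<Longrightarrow> gaps (Suc n) \<omega> = up_move (gaps n \<omega>)"
  "X (Suc n) \<omega> = X n \<omega> - 1 \<Longrightarrow> gaps (Suc n) \<omega> = down_move (gaps n \<omega>)"
  using gaps_up[of "\<lambda>k. X k \<omega>" n] gaps_down[of "\<lambda>k. X k \<omega>" n]
  by (simp_all add: gaps_def up_move_def down_move_def)

lemma gaps_markov:
  fixes f :: "nat \<times> nat \<Rightarrow> real"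
  assumes c: "c > 0" and f: "\<And>s. 0 \<le> f s"
  shows "expectation (\<lambda>\<omega>. f (gaps (Suc n) \<omega>)) = expectation (\<lambda>\<omega>. step_mean c f (gaps n \<omega>))"
proof -
  let ?U = "{\<omega> \<in> space M. X (Suc n) \<omega> = X n \<omega> + 1}" and ?D = "{\<omega> \<in> space M. X (Suc n) \<omega> = X n \<omega> - 1}"
  note p = up_prob_bounds[OF c]
  have nonneg: "0 \<le> step_mean c f s" for s
    using p f by (auto simp: step_mean_def intro!: add_nonneg_nonneg mult_nonneg_nonneg)
  have "(\<integral>\<^sup>+\<omega>. ennreal (f (gaps (Suc n) \<omega>)) \<partial>M)
      = (\<integral>\<^sup>+\<omega>. ennreal (f (up_move (gaps n \<omega>))) * indicator ?U \<omega>
            + ennreal (f (down_move (gaps n \<omega>))) * indicator ?D \<omega> \<partial>M)"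
    using AE_up_or_down[OF c, of n] AE_space
    by (intro nn_integral_cong_AE, eventually_elim) (auto simp: indicator_def gaps_next)
  also have "\<dots> = (\<integral>\<^sup>+\<omega>. ennreal (f (up_move (gaps n \<omega>))) * indicator ?U \<omega> \<partial>M)
      + (\<integral>\<^sup>+\<omega>. ennreal (f (down_move (gaps n \<omega>))) * indicator ?D \<omega> \<partial>M)"
    by (rule nn_integral_add) measurable
  also have "\<dots> = (\<integral>\<^sup>+\<omega>. ennreal (f (up_move (gaps n \<omega>))) * ennreal (up_prob c (gaps n \<omega>)) \<partial>M)
      + (\<integral>\<^sup>+\<omega>. ennreal (f (down_move (gaps n \<omega>))) * ennreal (1 - up_prob c (gaps n \<omega>)) \<partial>M)"
    by (simp only: nn_integral_up_step[OF c, of "\<lambda>s. ennreal (f (up_move s))"]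
        nn_integral_down_step[OF c, of "\<lambda>s. ennreal (f (down_move s))"])
  also have "\<dots> = (\<integral>\<^sup>+\<omega>. ennreal (f (up_move (gaps n \<omega>))) * ennreal (up_prob c (gaps n \<omega>))
      + ennreal (f (down_move (gaps n \<omega>))) * ennreal (1 - up_prob c (gaps n \<omega>)) \<partial>M)"
    by (rule nn_integral_add[symmetric]) measurable
  also have "\<dots> = (\<integral>\<^sup>+\<omega>. ennreal (step_mean c f (gaps n \<omega>)) \<partial>M)"
    using p f by (intro nn_integral_cong)
      (simp add: step_mean_def mult.commute flip: ennreal_plus ennreal_mult)
  finally show ?thesis
    using f nonneg by (simp add: integral_eq_nn_integral)
qed

definition range_size :: "nat \<Rightarrow> 'a \<Rightarrow> nat" where
  "range_size n \<omega> = fst (gaps n \<omega>) + snd (gaps n \<omega>)"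

lemma walk_range_eq: "walk_range X n \<omega> = real (range_size n \<omega>)"
  by (simp add: walk_range_def path_range_eq_gaps range_size_def gaps_def)

lemma range_size_measurable [measurable]: "range_size n \<in> M \<rightarrow>\<^sub>M count_space UNIV"
  unfolding range_size_def[abs_def]
  by (rule measurable_compose[OF gaps_measurable, where g = "\<lambda>s. fst s + snd s"]) simp

lemma range_size_0 [simp]: "range_size 0 \<omega> = 0"
  by (simp add: range_size_def gaps_def gaps_0)

lemma range_size_mono: "range_size n \<omega> \<le> range_size (Suc n) \<omega>"
  using path_range_mono[of "\<lambda>k. X k \<omega>" n] by (simp add: path_range_eq_gaps range_size_def gaps_def)

lemma AE_range_size_le:
  assumes "c > 0"
  shows "AE \<omega> in M. range_size n \<omega> \<le> n"
proof (induction n)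
  case (Suc n)
  then show ?case
    using AE_up_or_down[OF assms, of n]
  proof eventually_elim
    case (elim \<omega>)
    then show ?case
      by (cases "gaps n \<omega>") (auto simp: range_size_def gaps_next up_move_def down_move_def)
  qed
qed simp

definition range_tail :: "nat \<Rightarrow> nat \<Rightarrow> real" where
  "range_tail n N = \<P>(\<omega> in M. N \<le> range_size n \<omega>)"

lemma range_tail_mono: "range_tail n N \<le> range_tail (Suc n) N"
  unfolding range_tail_def using range_size_mono[of n]
  by (intro finite_measure_mono) (auto intro: order_trans)

text \<open>
  Optional stopping for the martingale above, written out in time. If \<open>g n\<close> is the expected weight
  on the event that the range is still below \<open>N\<close> at time \<open>n\<close>, then the discounted difference
  \<open>s ^ n * g n - s ^ Suc n * g (Suc n)\<close> is \<open>s ^ Suc n\<close> times the probability that the range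
  reaches \<open>N\<close> at time \<open>Suc n\<close>. The sum telescopes to \<open>g 0\<close>, because \<open>g\<close> is bounded and
  \<open>s < 1\<close>.
\<close>
lemma hitting_time_generating_function:
  assumes c: "c > 0" and \<theta>: "\<theta> > 0" and N: "N > 0"
  shows "(\<lambda>n. (range_tail (Suc n) N - range_tail n N) * (1 / cosh \<theta>) ^ Suc n) sums hitting_gf c \<theta> N"
proof -
  let ?w = "discounted_weight c \<theta> N"
  define g where "g n = expectation (\<lambda>\<omega>. ?w (gaps n \<omega>) * indicator {s. fst s + snd s < N} (gaps n \<omega>))" for n
  define s where "s = 1 / cosh \<theta>"
  have w: "0 \<le> ?w t" "?w t \<le> 1" for t using discounted_weight_bounds[OF c \<theta>] by auto
  have int: "integrable M (\<lambda>\<omega>. f (gaps n \<omega>))" if "\<And>t. \<bar>f t\<bar> \<le> 1" for f :: "nat \<times> nat \<Rightarrow> real" and n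
    by (rule integrable_const_bound[where B = 1]) (use that in auto)
  have int_g: "integrable M (\<lambda>\<omega>. ?w (gaps n \<omega>) * indicator {s. fst s + snd s < N} (gaps n \<omega>))" for n
    by (rule int[of "\<lambda>t. ?w t * indicator {s. fst s + snd s < N} t"]) (use w in \<open>auto simp: indicator_def abs_of_nonneg\<close>)
  have int_t: "integrable M (\<lambda>\<omega>. indicator {s. N \<le> fst s + snd s} (gaps n \<omega>) :: real)" for n
    by (rule int) (auto simp: indicator_def)
  have tail: "range_tail n N = expectation (\<lambda>\<omega>. indicator {s. N \<le> fst s + snd s} (gaps n \<omega>))" for n
  proof -
    have "expectation (\<lambda>\<omega>. indicator {s. N \<le> fst s + snd s} (gaps n \<omega>) :: real)
        = expectation (indicator {\<omega> \<in> space M. N \<le> range_size n \<omega>})"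
      by (intro Bochner_Integration.integral_cong) (auto simp: indicator_def range_size_def)
    then show ?thesis by (simp add: range_tail_def)
  qed
  have stopped: "stopped_weight c \<theta> N t = ?w t * indicator {s. fst s + snd s < N} t
      + indicator {s. N \<le> fst s + snd s} t" for t
    by (auto simp: stopped_weight_def indicator_def)
  have step: "g (Suc n) + range_tail (Suc n) N = cosh \<theta> * g n + range_tail n N" for n
  proof -
    have "g (Suc n) + range_tail (Suc n) N = expectation (\<lambda>\<omega>. stopped_weight c \<theta> N (gaps (Suc n) \<omega>))"
      unfolding g_def tail stopped by (rule Bochner_Integration.integral_add[symmetric, OF int_g int_t])
    also have "\<dots> = expectation (\<lambda>\<omega>. step_mean c (stopped_weight c \<theta> N) (gaps n \<omega>))"
      by (rule gaps_markov[OF c]) (simp add: stopped_weight_def w)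
    also have "\<dots> = expectation (\<lambda>\<omega>. cosh \<theta> * (?w (gaps n \<omega>) * indicator {s. fst s + snd s < N} (gaps n \<omega>))
        + indicator {s. N \<le> fst s + snd s} (gaps n \<omega>))"
      by (intro Bochner_Integration.integral_cong)
         (auto simp: step_mean_stopped_weight[OF c] indicator_def)
    also have "\<dots> = cosh \<theta> * g n + range_tail n N"
      unfolding g_def tail using int_g int_t by (subst Bochner_Integration.integral_add) auto
    finally show ?thesis .
  qed
  have g_bounds: "0 \<le> g n" "g n \<le> 1" for n
  proof -
    show "0 \<le> g n" unfolding g_def using w by (intro integral_nonneg_AE) auto
    have "g n \<le> expectation (\<lambda>\<omega>. 1)"
      unfolding g_def by (intro integral_mono int_g) (use w in \<open>auto simp: indicator_def\<close>)
    then show "g n \<le> 1" by (simp add: prob_space)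
  qed
  have "1 < cosh \<theta>" using \<theta> cosh_real_ge_1[of \<theta>] cosh_real_one_iff[of \<theta>] by linarith
  then have s: "0 < s" "s < 1" "s * cosh \<theta> = 1" by (auto simp: s_def)
  have "(\<lambda>n. s ^ n * g n) \<longlonglongrightarrow> 0"
  proof (rule tendsto_sandwich[OF _ _ tendsto_const])
    show "(\<lambda>n. s ^ n) \<longlonglongrightarrow> 0" using s by (intro LIMSEQ_power_zero) auto
  qed (use s g_bounds in \<open>auto intro!: always_eventually mult_left_le\<close>)
  then have "(\<lambda>n. s ^ n * g n - s ^ Suc n * g (Suc n)) sums (s ^ 0 * g 0 - 0)"
    by (rule telescope_sums')
  moreover have "s ^ n * g n - s ^ Suc n * g (Suc n) = (range_tail (Suc n) N - range_tail n N) * s ^ Suc n" for n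
  proof -
    have "s ^ n * g n = s ^ Suc n * (cosh \<theta> * g n)"
      using s(3) by (simp add: mult.assoc[symmetric])
    also have "cosh \<theta> * g n = g (Suc n) + range_tail (Suc n) N - range_tail n N"
      using step[of n] by simp
    finally show ?thesis by (simp add: algebra_simps)
  qed
  moreover have "g 0 = hitting_gf c \<theta> N"
    using N by (simp add: g_def gaps_def gaps_0 discounted_weight_edge hitting_gf_def prob_space atLeast0LessThan)
  ultimately show ?thesis by (simp add: s_def)
qed

end

section \<open>Moments of the range\<close>

text \<open>
  The event that the range is at least \<open>x\<close> depends on \<open>x\<close> only through its ceiling, so moments of
  an integer variable become integrals of its tail over the real half-line. This form passes to
  the limit without a separate comparison of sums with integrals.
\<close>
lemma has_bochner_integral_moment_kernel:
  assumes "l \<ge> 1"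
  shows "has_bochner_integral lborel (\<lambda>x. moment_kernel l x * of_bool (nat \<lceil>x\<rceil> \<le> m)) (real m ^ l)"
proof -
  have "has_bochner_integral lborel (\<lambda>x. real l * x ^ (l - 1) * indicator {0..real m} x) (real m ^ l - 0 ^ l)"
    by (rule has_bochner_integral_FTC_Icc_nonneg) (auto intro!: derivative_eq_intros continuous_intros)
  then have "has_bochner_integral lborel (\<lambda>x. real l * x ^ (l - 1) * indicator {0..real m} x) (real m ^ l)"
    using assms by (cases l) (simp_all del: power_Suc add: power_0_Suc)
  moreover have "AE x in lborel. real l * x ^ (l - 1) * indicator {0..real m} x
      = moment_kernel l x * of_bool (nat \<lceil>x\<rceil> \<le> m)"
    using AE_lborel_singleton[of "0 :: real"]
  proof eventually_elim
    case (elim x)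
    have "nat \<lceil>x\<rceil> \<le> m \<longleftrightarrow> x \<le> real m" if "x > 0" using that by linarith
    then show ?case using elim by (auto simp: moment_kernel_def indicator_def)
  qed
  moreover have "(\<lambda>x. moment_kernel l x * of_bool (nat \<lceil>x\<rceil> \<le> m)) \<in> borel_measurable lborel"
  proof -
    have "(\<lambda>x::real. of_bool (nat \<lceil>x\<rceil> \<le> m) :: real) \<in> borel_measurable borel"
      by (rule measurable_compose[OF measurable_real_ceiling, of "\<lambda>i. of_bool (nat i \<le> m)"]) simp
    then show ?thesis by measurable
  qed
  ultimately show ?thesis
    by (subst has_bochner_integral_cong_AE[symmetric]) (auto simp: has_bochner_integral_iff)
qed

context once_reinforced_random_walk
begin

text \<open>
  After \<open>n\<close> steps the range is at most \<open>n\<close>, so every expectation is a finite sum.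
\<close>
lemma expectation_range_size:
  fixes h :: "nat \<Rightarrow> real"
  assumes "c > 0"
  shows "expectation (\<lambda>\<omega>. h (range_size n \<omega>)) = (\<Sum>m\<le>n. h m * \<P>(\<omega> in M. range_size n \<omega> = m))"
proof -
  have "expectation (\<lambda>\<omega>. h (range_size n \<omega>))
      = expectation (\<lambda>\<omega>. \<Sum>m\<le>n. h m * indicator {\<omega> \<in> space M. range_size n \<omega> = m} \<omega>)"
  proof (rule integral_cong_AE)
    show "(\<lambda>\<omega>. h (range_size n \<omega>)) \<in> borel_measurable M"
      by (rule measurable_compose[OF range_size_measurable]) simp
    show "AE \<omega> in M. h (range_size n \<omega>) = (\<Sum>m\<le>n. h m * indicator {\<omega> \<in> space M. range_size n \<omega> = m} \<omega>)"
      using AE_range_size_le[OF assms, of n] AE_space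
    proof eventually_elim
      case (elim \<omega>)
      have "(\<Sum>m\<le>n. h m * indicator {\<omega> \<in> space M. range_size n \<omega> = m} \<omega>)
          = (\<Sum>m\<le>n. if m = range_size n \<omega> then h m else 0)"
        using elim by (intro sum.cong) (auto simp: indicator_def)
      then show ?case using elim by simp
    qed
  qed measurable
  also have "\<dots> = (\<Sum>m\<le>n. h m * \<P>(\<omega> in M. range_size n \<omega> = m))"
    by (subst Bochner_Integration.integral_sum)
       (auto intro!: integrable_mult_right integrable_real_indicator simp: emeasure_eq_measure)
  finally show ?thesis .
qed

definition range_moment :: "nat \<Rightarrow> nat \<Rightarrow> real" where
  "range_moment l n = expectation (\<lambda>\<omega>. walk_range X n \<omega> ^ l)"

lemma range_moment_layer_cake:
  assumes "c > 0" "l \<ge> 1"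
  shows "has_bochner_integral lborel (\<lambda>x. moment_kernel l x * range_tail n (nat \<lceil>x\<rceil>)) (range_moment l n)"
proof -
  have "range_tail n N = expectation (\<lambda>\<omega>. of_bool (N \<le> range_size n \<omega>))" for N
  proof -
    have "expectation (\<lambda>\<omega>. of_bool (N \<le> range_size n \<omega>) :: real)
        = expectation (indicator {\<omega> \<in> space M. N \<le> range_size n \<omega>})"
      by (intro Bochner_Integration.integral_cong) (auto simp: indicator_def)
    then show ?thesis by (simp add: range_tail_def)
  qed
  then have tail: "range_tail n N = (\<Sum>m\<le>n. of_bool (N \<le> m) * \<P>(\<omega> in M. range_size n \<omega> = m))" for N
    using expectation_range_size[OF assms(1), of "\<lambda>m. of_bool (N \<le> m)"] by simp
  have moment: "range_moment l n = (\<Sum>m\<le>n. real m ^ l * \<P>(\<omega> in M. range_size n \<omega> = m))"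
    unfolding range_moment_def walk_range_eq
    by (rule expectation_range_size[OF assms(1), of "\<lambda>m. real m ^ l"])
  have "has_bochner_integral lborel
      (\<lambda>x. \<Sum>m\<le>n. (moment_kernel l x * of_bool (nat \<lceil>x\<rceil> \<le> m)) * \<P>(\<omega> in M. range_size n \<omega> = m)) (range_moment l n)"
    unfolding moment
    by (intro has_bochner_integral_sum has_bochner_integral_mult_left has_bochner_integral_moment_kernel assms)
  then show ?thesis by (simp only: tail sum_distrib_left mult.assoc)
qed

lemma range_moment_mono:
  assumes "c > 0" "l \<ge> 1"
  shows "range_moment l n \<le> range_moment l (Suc n)"
proof -
  note cake = range_moment_layer_cake[OF assms]
  have "range_moment l k = (\<integral>x. moment_kernel l x * range_tail k (nat \<lceil>x\<rceil>) \<partial>lborel)" for k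
    using cake[of k] by (simp add: has_bochner_integral_iff)
  moreover have "(\<integral>x. moment_kernel l x * range_tail n (nat \<lceil>x\<rceil>) \<partial>lborel)
      \<le> (\<integral>x. moment_kernel l x * range_tail (Suc n) (nat \<lceil>x\<rceil>) \<partial>lborel)"
    using cake[of n] cake[of "Suc n"]
    by (intro integral_mono mult_left_mono moment_kernel_nonneg range_tail_mono)
       (auto simp only: has_bochner_integral_iff)
  ultimately show ?thesis by simp
qed

text \<open>
  Summation over time under the moment integral. All terms are nonnegative, since the range is
  nondecreasing in time, and so the exchange also proves that the series converges.
\<close>
lemma range_moment_generating_function:
  assumes c: "c > 0" and l: "l \<ge> 1" and \<theta>: "\<theta> > 0"
  shows "(\<lambda>n. (range_moment l (Suc n) - range_moment l n) * (1 / cosh \<theta>) ^ Suc n) sums moment_transform c l \<theta>"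
proof -
  let ?s = "1 / cosh \<theta>"
  define f where "f n x = moment_kernel l x * ((range_tail (Suc n) (nat \<lceil>x\<rceil>) - range_tail n (nat \<lceil>x\<rceil>)) * ?s ^ Suc n)"
    for n x
  define d where "d n = (range_moment l (Suc n) - range_moment l n) * ?s ^ Suc n" for n
  have f_nonneg: "0 \<le> f n x" for n x
    using moment_kernel_nonneg range_tail_mono by (auto simp: f_def intro!: mult_nonneg_nonneg)
  have d_nonneg: "0 \<le> d n" for n
    using range_moment_mono[OF c l] by (auto simp: d_def intro!: mult_nonneg_nonneg)
  have "has_bochner_integral lborel (\<lambda>x. (moment_kernel l x * range_tail (Suc n) (nat \<lceil>x\<rceil>)
      - moment_kernel l x * range_tail n (nat \<lceil>x\<rceil>)) * ?s ^ Suc n) (d n)" for n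
    unfolding d_def by (intro has_bochner_integral_mult_left has_bochner_integral_diff range_moment_layer_cake c l)
  moreover have "f n = (\<lambda>x. (moment_kernel l x * range_tail (Suc n) (nat \<lceil>x\<rceil>)
      - moment_kernel l x * range_tail n (nat \<lceil>x\<rceil>)) * ?s ^ Suc n)" for n
    unfolding f_def by (simp only: right_diff_distrib left_diff_distrib mult.assoc)
  ultimately have f_int: "has_bochner_integral lborel (f n) (d n)" for n
    by (simp only:)
  have f_meas [measurable]: "f n \<in> borel_measurable lborel" for n
    using f_int[of n] by (auto simp: has_bochner_integral_iff)
  have "(\<Sum>n. ennreal (d n)) = (\<Sum>n. \<integral>\<^sup>+x. ennreal (f n x) \<partial>lborel)"
    using f_int f_nonneg by (intro suminf_cong) (simp add: nn_integral_eq_integral has_bochner_integral_iff)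
  also have "\<dots> = (\<integral>\<^sup>+x. (\<Sum>n. ennreal (f n x)) \<partial>lborel)"
    by (rule nn_integral_suminf[symmetric]) measurable
  also have "\<dots> = (\<integral>\<^sup>+x. ennreal (moment_kernel l x * hitting_gf c \<theta> (nat \<lceil>x\<rceil>)) \<partial>lborel)"
  proof (intro nn_integral_cong suminf_ennreal_eq f_nonneg)
    fix x
    show "(\<lambda>n. f n x) sums (moment_kernel l x * hitting_gf c \<theta> (nat \<lceil>x\<rceil>))"
    proof (cases "x > 0")
      case True
      then show ?thesis
        unfolding f_def by (intro sums_mult hitting_time_generating_function c \<theta>) simp
    qed (simp add: f_def moment_kernel_def)
  qed
  also have "\<dots> = ennreal (moment_transform c l \<theta>)"
    unfolding moment_transform_def
    using integrable_moment_transform[OF c l \<theta>] moment_kernel_nonneg less_imp_le[OF hitting_gf_pos[OF c \<theta>]]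
    by (intro nn_integral_eq_integral) auto
  finally have sum: "(\<Sum>n. ennreal (d n)) = ennreal (moment_transform c l \<theta>)" .
  have "moment_transform c l \<theta> \<ge> 0"
    unfolding moment_transform_def
    using moment_kernel_nonneg less_imp_le[OF hitting_gf_pos[OF c \<theta>]] by (intro integral_nonneg_AE) auto
  moreover have summable: "summable d"
    by (rule summable_suminf_not_top[OF d_nonneg]) (simp add: sum)
  moreover have "suminf d \<ge> 0" by (intro suminf_nonneg summable d_nonneg)
  ultimately have "suminf d = moment_transform c l \<theta>"
    using sum suminf_ennreal2[OF d_nonneg summable] by simp
  then show ?thesis using summable unfolding d_def by (simp add: sums_iff)
qed

text \<open>
  Karamata's theorem for the increments in time of the \<open>l\<close>-th moment, with exponent \<open>l / 2\<close>. The
  substitution \<open>exp t = cosh \<theta>\<close> relates the two parameters, and \<open>t = ln (cosh \<theta>)\<close> is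
  asymptotic to \<open>\<theta> ^ 2 / 2\<close>, which is the source of the power of \<open>2\<close> in the constant.
\<close>
theorem range_moment_asymptotics:
  assumes c: "c > 0" and l: "l \<ge> 1"
  shows "(\<lambda>n. range_moment l n / real n powr (real l / 2))
    \<longlonglongrightarrow> 2 powr (- (real l / 2)) * (real l * J l c) / Gamma (real l / 2 + 1)"
proof -
  define b where "b n = (case n of 0 \<Rightarrow> 0 | Suc m \<Rightarrow> range_moment l (Suc m) - range_moment l m)" for n
  have b_Suc: "b (Suc n) = range_moment l (Suc n) - range_moment l n" and b_0: "b 0 = 0" for n
    by (simp_all add: b_def)
  have partial: "(\<Sum>k\<le>n. b k) = range_moment l n" for n
  proof (induction n)
    case 0
    show ?case using l by (simp add: b_0 range_moment_def walk_range_eq)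
  qed (simp add: b_Suc)
  have gf: "(\<lambda>k. b k * exp (- (real k * t))) sums moment_transform c l (arcosh (exp t))" if t: "t > 0" for t
  proof -
    let ?f = "\<lambda>k. b k * exp (- (real k * t))"
    have "arcosh (exp t) > 0" using t by simp
    then have "(\<lambda>n. b (Suc n) * (1 / cosh (arcosh (exp t))) ^ Suc n) sums moment_transform c l (arcosh (exp t))"
      unfolding b_Suc by (rule range_moment_generating_function[OF c l])
    moreover have "(1 / cosh (arcosh (exp t))) ^ k = exp (- (real k * t))" for k
      using t by (simp add: exp_of_nat_mult exp_minus power_one_over inverse_eq_divide)
    ultimately have "(\<lambda>n. ?f (Suc n)) sums moment_transform c l (arcosh (exp t))" by (simp only:)
    then have "?f sums (moment_transform c l (arcosh (exp t)) + ?f 0)"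
      by (rule sums_Suc)
    then show ?thesis by (simp add: b_0)
  qed
  have arcosh_lim: "filterlim (\<lambda>t::real. arcosh (exp t)) (at_right 0) (at_right 0)"
  proof -
    have "filterlim (\<lambda>t::real. exp t) (at_right 1) (at_right 0)" by real_asymp
    then have "((\<lambda>t::real. arcosh (exp t)) \<longlongrightarrow> 0) (at_right 0)"
      by (rule filterlim_compose[OF tendsto_arcosh_at_left_1])
    moreover have "\<forall>\<^sub>F t::real in at_right 0. arcosh (exp t) \<in> {0<..} \<and> arcosh (exp t) \<noteq> 0"
      using eventually_at_right_less[of 0] by eventually_elim auto
    ultimately show ?thesis unfolding filterlim_at by simp
  qed
  have ln_cosh_lim: "((\<lambda>\<theta>::real. ln (cosh \<theta>) / \<theta>\<^sup>2) \<longlongrightarrow> 1 / 2) (at_right 0)"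
    unfolding cosh_field_def by real_asymp
  have "((\<lambda>\<theta>. (ln (cosh \<theta>) / \<theta>\<^sup>2) powr (real l / 2) * (\<theta> ^ l * moment_transform c l \<theta>))
      \<longlongrightarrow> (1 / 2) powr (real l / 2) * (real l * J l c)) (at_right 0)"
    by (intro tendsto_intros ln_cosh_lim moment_transform_asymptotics c l) auto
  from filterlim_compose[OF this arcosh_lim]
  have "((\<lambda>t. t powr (real l / 2) * (\<Sum>k. b k * exp (- (real k * t))))
      \<longlongrightarrow> (1 / 2) powr (real l / 2) * (real l * J l c)) (at_right 0)"
  proof (rule Lim_transform_eventually)
    show "\<forall>\<^sub>F t in at_right 0. (ln (cosh (arcosh (exp t))) / (arcosh (exp t))\<^sup>2) powr (real l / 2)
        * (arcosh (exp t) ^ l * moment_transform c l (arcosh (exp t)))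
      = t powr (real l / 2) * (\<Sum>k. b k * exp (- (real k * t)))"
      using eventually_at_right_less[of 0]
    proof eventually_elim
      case (elim t)
      define \<theta> where "\<theta> = arcosh (exp t)"
      have \<theta>: "\<theta> > 0" "cosh \<theta> = exp t" using elim by (auto simp: \<theta>_def)
      have "(\<theta>\<^sup>2) powr (real l / 2) = (\<theta> powr 2) powr (real l / 2)"
        using \<theta>(1) by simp
      also have "\<dots> = \<theta> ^ l" using \<theta>(1) by (simp only: powr_powr) (simp add: powr_realpow)
      finally have "(ln (cosh \<theta>) / \<theta>\<^sup>2) powr (real l / 2) * (\<theta> ^ l * moment_transform c l \<theta>)
          = t powr (real l / 2) * moment_transform c l \<theta>"
        using \<theta> elim by (simp add: powr_divide)
      then show ?case
        using sums_unique[OF gf[OF elim]] by (simp only: \<theta>_def)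
    qed
  qed
  then have lim: "((\<lambda>t. t powr (real l / 2) * (\<Sum>k. b k * exp (- (real k * t))))
      \<longlongrightarrow> 2 powr (- (real l / 2)) * (real l * J l c)) (at_right 0)"
    by (simp add: powr_divide powr_minus_divide)
  interpret laplace_asymptotics b "real l / 2" "2 powr (- (real l / 2)) * (real l * J l c)"
  proof
    show "b k \<ge> 0" for k
      using range_moment_mono[OF c l] by (simp add: b_def split: nat.splits)
    show "summable (\<lambda>k. b k * exp (- (real k * t)))" if "t > 0" for t
      using gf[OF that] by (rule sums_summable)
  qed (use l lim in auto)
  show ?thesis using karamata_partial_sums unfolding partial .
qed

lemma normalized_moment_asymp_equiv:
  assumes c: "c > 0" and l: "l \<ge> 1"
  shows "(\<lambda>n. expectation (\<lambda>\<omega>. (walk_range X n \<omega> / sqrt (real n)) ^ l))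
    \<sim>[sequentially] (\<lambda>n. 1 / (2 powr ((real l - 2) / 2) * Gamma (real l / 2)) * J l c)"
proof (rule tendsto_imp_asymp_equiv_const)
  have G: "Gamma (real l / 2) > 0" using l by (intro Gamma_real_pos) auto
  have Gamma: "Gamma (real l / 2 + 1) = real l / 2 * Gamma (real l / 2)"
    using l nonpos_Ints_nonpos[of "real l / 2"] by (intro Gamma_plus1) auto
  have powr: "2 powr ((real l - 2) / 2) = 2 powr (real l / 2) / (2 :: real)"
    by (simp add: diff_divide_distrib powr_diff)
  have const: "2 powr (- (real l / 2)) * (real l * J l c) / Gamma (real l / 2 + 1)
      = 1 / (2 powr ((real l - 2) / 2) * Gamma (real l / 2)) * J l c"
    unfolding Gamma powr using l G by (simp add: powr_minus field_simps)
  have "\<forall>\<^sub>F n in sequentially. range_moment l n / real n powr (real l / 2)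
      = expectation (\<lambda>\<omega>. (walk_range X n \<omega> / sqrt (real n)) ^ l)"
    using eventually_gt_at_top[of 0]
  proof eventually_elim
    case (elim n)
    have "real n powr (real l / 2) = sqrt (real n) ^ l"
      using elim powr_powr[of "real n" "1 / 2" "real l"] by (simp add: powr_half_sqrt powr_realpow)
    then show ?case by (simp add: power_divide range_moment_def)
  qed
  with range_moment_asymptotics[OF c l, unfolded const]
  show "(\<lambda>n. expectation (\<lambda>\<omega>. (walk_range X n \<omega> / sqrt (real n)) ^ l))
      \<longlonglongrightarrow> 1 / (2 powr ((real l - 2) / 2) * Gamma (real l / 2)) * J l c"
    by (rule Lim_transform_eventually)
  show "1 / (2 powr ((real l - 2) / 2) * Gamma (real l / 2)) * J l c \<noteq> 0"
    using G J_pos[OF c l] by simp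
qed

end

theorem theorem1:
  fixes M :: "'a measure" and X :: "nat \<Rightarrow> 'a \<Rightarrow> int" and c :: real
  assumes "c > 0"
    and "once_reinforced_random_walk M X c"
  shows "(\<forall>l::nat. l \<ge> 1 \<longrightarrow>
            (\<lambda>n. integral\<^sup>L M (\<lambda>\<omega>. (walk_range X n \<omega> / sqrt (real n)) ^ l))
              \<sim>[sequentially]
            (\<lambda>n. 1 / (2 powr ((real l - 2) / 2) * Gamma (real l / 2)) * J l c)) \<and>
         (\<lambda>n. integral\<^sup>L M (\<lambda>\<omega>. walk_range X n \<omega> / sqrt (real n)))
           \<sim>[sequentially] (\<lambda>n. sqrt (2 / pi) * J 1 c) \<and>
         (\<lambda>n. integral\<^sup>L M (\<lambda>\<omega>. (walk_range X n \<omega>)\<^sup>2 / real n))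
           \<sim>[sequentially] (\<lambda>n. J 2 c)"
proof -
  interpret once_reinforced_random_walk M X c by fact
  note asymp = normalized_moment_asymp_equiv[OF assms(1)]
  have "1 / (2 powr ((real 1 - 2) / 2) * Gamma (real 1 / 2)) = sqrt (2 / pi)"
    by (simp add: powr_minus powr_half_sqrt Gamma_one_half_real real_sqrt_divide field_simps)
  then have "(\<lambda>n. integral\<^sup>L M (\<lambda>\<omega>. walk_range X n \<omega> / sqrt (real n)))
      \<sim>[sequentially] (\<lambda>n. sqrt (2 / pi) * J 1 c)"
    using asymp[of 1] by (simp only: power_one_right order_refl)
  moreover have "1 / (2 powr ((real 2 - 2) / 2) * Gamma (real 2 / 2)) = 1" by simp
  then have "(\<lambda>n. integral\<^sup>L M (\<lambda>\<omega>. (walk_range X n \<omega>)\<^sup>2 / real n)) \<sim>[sequentially] (\<lambda>n. J 2 c)"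
    using asymp[of 2] by (simp add: power_divide)
  ultimately show ?thesis using asymp by blast
qed

end
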